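(* Let $A_c\in\mathbb{R}^{n\times n}$, $B_c\in\mathbb{R}^{n\times m}$, $A_d\in\mathbb{R}^{n\times n}$, $B_d\in\mathbb{R}^{n\times m}$, and let $\bm{\Sigma}_c:\ \dot x_c(t)=A_cx_c(t)+B_cu_c(t)$ and $\bm{\Sigma}_d:\ x_d(i+1)=A_dx_d(i)+B_du_d(i)$. Let $\tau\in\mathbb{R}_{>0}$, let $N\ge1$ be an integer, and let $\bm{\Sigma}_c$ be an $N$-th order interpolator of $\bm{\Sigma}_d$ with respect to the sampling time $\tau$. Let $\ell\in\mathbb{Z}_{>0}$, let $\pi_0,\pi_1,\dots,\pi_\ell\subset\mathbb{R}^n$ be regions of interest, let $x_0\in\mathbb{R}^n$, and let $u_d:\llbracket 0,\ell\rrbracket\to\mathbb{R}^m$ be such that $x_d(i;x_0,u_d)\in\pi_i$ for all $i\in\llbracket 0,\ell\rrbracket$. Take any $u_c\in\mathcal{U}_c(x_0,u_d)$. For any integer $0\le i\le\ell-1$, let $u_c^i\in\mathcal{U}_c^i(x_0,u_d)$ and the matrices $U^i=[U_1^i\ \cdots\ U_N^i]\in\mathbb{R}^{m\times N}$ and $X^i\in\mathbb{R}^{n\times N}$ be such that $u_c(i\tau+t)=u_c^i(t)$ for all $t\in[0,\tau]$, $$\begin{bmatrix}\psi_0^\top\otimes I & 0\\ \Psi^\top\oplus(-A_c) & -I\otimes B_c\\ \Phi^\top\otimes I & 0\\ 0 & \Phi^\top\otimes I\end{bmatrix}\begin{bmatrix}\operatorname{vec}(X^i)\\ \operatorname{vec}(U^i)\end{bmatrix}=\begin{bmatrix}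 A_c-\dot\phi_0(0)I & B_c & 0\\ -\sigma^\top\otimes I & 0 & 0\\ A_d-\phi_0(\tau)I & B_d & 0\\ 0 & -\phi_0(\tau)I & I\end{bmatrix}\begin{bmatrix}x_d(i;x_0,u_d)\\ u_d(i)\\ u_d(i+1)\end{bmatrix},$$ and $u_c^i(t)=\phi_0(t)u_d(i)+\sum_{j=1}^N\phi_j(t)U_j^i$ for all $t\in[0,\tau]$. Then, given a region $\pi\subset\mathbb{R}^n$, for all $t\in[0,\tau]$, $$\operatorname{d}\big(x_c(i\tau+t;x_0,u_c),\pi\big)\le\frac{6^{1/2}\tau N}{N+1}\big|A_cx_d(i;x_0,u_d)+B_cu_d(i)\big|+\frac{(6\tau)^{1/2}N}{N+1}\left|\begin{bmatrix}\operatorname{vec}(X^i)\\ \operatorname{vec}(U^i)\end{bmatrix}\right|_{\Delta_N^\tau(A_c,B_c)}+\min\big\{\operatorname{dH}(\pi_i,\pi),\operatorname{dH}(\pi_{i+1},\pi)\big\}.$$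
   Context: For integers $k_1\le k_2$, $\llbracket k_1,k_2\rrbracket=\{k\in\mathbb{Z}: k_1\le k\le k_2\}$. $x_c(t;x_0,u_c)$ denotes the solution at time $t$ of $\dot x_c=A_cx_c+B_cu_c$ with $x_c(0)=x_0$ and input $u_c$; $x_d(i;x_0,u_d)$ denotes the solution at step $i$ of $x_d(i+1)=A_dx_d(i)+B_du_d(i)$ with $x_d(0)=x_0$ and input $u_d$. $f|_{I'}$ denotes restriction to $I'$. $\mathbb{P}_N^p$ is the space of $\mathbb{R}^p$-valued polynomials of degree at most $N$. Signal interpolation: for $\ell,p\in\mathbb{Z}_{>0}$ and $s_d:\llbracket 0,\ell\rrbracket\to\mathbb{R}^p$, a function $s_c:[0,\ell\tau]\to\mathbb{R}^p$ is an $N$-th order interpolation of $s_d$ with respect to the sampling time $\tau$ if there exist $P_0,\dots,P_{\ell-1}\in\mathbb{P}_N^p|_{[0,\tau]}$ such that for all $i\in\llbracket 0,\ell-1\rrbracket$: $s_c(i\tau)=s_d(i)$, $s_c((i+1)\tau)=s_d(i+1)$, and $s_c(i\tau+t)=P_i(t)$ for all $t\in[0,\tau]$. The set of all such $s_c$ is denoted $\mathbb{I}_N^\tau(s_d)$. System interpolation: $\bm{\Sigma}_c$ is an $N$-th order interpolator of $\bm{\Sigma}_d$ with respect to the sampling time $\tau$ if for any $\ell\in\mathbb{Z}_{>0}$, any $x_0\in\mathbb{R}^n$ and any $u_d:\llbracket 0,\ell\rrbracket\to\mathbb{R}^m$, there exists $u_c\in\mathbb{I}_N^\tau(u_d)$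 such that $x_c(\cdot;x_0,u_c)|_{[0,\ell\tau]}\in\mathbb{I}_N^\tau\big(x_d(\cdot;x_0,u_d)|_{\llbracket 0,\ell\rrbracket}\big)$. Quadrature nodes: let $\mathfrak{L}_k(t)=\frac{1}{2^k}\sum_{i=0}^{\lfloor k/2\rfloor}(-1)^i\binom{k}{i}\binom{2k-2i}{k}t^{k-2i}$ be the standard Legendre polynomial of degree $k$, and $\mathfrak{L}_k^\tau(t)=\mathfrak{L}_k(2t/\tau-1)$ the shifted one. The nodes $t_{N,0}<t_{N,1}<\dots<t_{N,N}$ are the $N+1$ distinct (real) zeros of $\mathfrak{L}_N^\tau+\mathfrak{L}_{N+1}^\tau$; they satisfy $t_{N,0}=0$ and $t_{N,N}<\tau$. For $i=0,\dots,N$ let $\phi_i(t)=\prod_{j=0,j\ne i}^{N}\frac{t-t_{N,j}}{t_{N,i}-t_{N,j}}$, with derivative $\dot\phi_i$. Define $\Phi=(\phi_1(\tau),\dots,\phi_N(\tau))^\top\in\mathbb{R}^N$; $\psi_j=(\dot\phi_1(t_{N,j}),\dots,\dot\phi_N(t_{N,j}))^\top\in\mathbb{R}^N$ for $j=0,\dots,N$; $\Psi=[\psi_1\ \psi_2\ \cdots\ \psi_N]\in\mathbb{R}^{N\times N}$; $\sigma=[\dot\phi_0(t_{N,1})\ \cdots\ \dot\phi_0(t_{N,N})]\in\mathbb{R}^{1\times N}$. $\otimes$ is the Kronecker product, $N_1\oplus M_1=N_1\otimes I+I\otimes M_1$ is the Kronecker sum of square matrices (so $\Psi^\top\oplus(-A_c)=\Psi^\top\otimes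 I_n-I_N\otimes A_c$), $\operatorname{vec}$ is column-stacking vectorization, and $I$, $0$ are identity and zero matrices of appropriate size. The sets of inputs: for $0\le i\le\ell-1$, consider matrices $X^i\in\mathbb{R}^{n\times N}$ and $U^i=[U^i_1\ \cdots\ U^i_N]\in\mathbb{R}^{m\times N}$ satisfying $$\text{(a)}\quad \begin{bmatrix}\psi_0^\top\otimes I & 0\\ \Psi^\top\oplus(-A_c) & -I\otimes B_c\\ \Phi^\top\otimes I & 0\\ 0 & \Phi^\top\otimes I\end{bmatrix}\begin{bmatrix}\operatorname{vec}(X^i)\\ \operatorname{vec}(U^i)\end{bmatrix}=\begin{bmatrix} A_c-\dot\phi_0(0)I & B_c & 0\\ -\sigma^\top\otimes I & 0 & 0\\ A_d-\phi_0(\tau)I & B_d & 0\\ 0 & -\phi_0(\tau)I & I\end{bmatrix}\begin{bmatrix}x_d(i;x_0,u_d)\\ u_d(i)\\ u_d(i+1)\end{bmatrix},$$ and functions $u_c^i\in\mathbb{P}_N^m|_{[0,\tau]}$ satisfying $$\text{(b)}\quad u_c^i(t)=\phi_0(t)u_d(i)+\sum_{j=1}^N\phi_j(t)U^i_j\quad\text{for all }t\in[0,\tau].$$ Let $\mathcal{U}_c^i(x_0,u_d)$ be the set of all $u_c^i\in\mathbb{P}_N^m|_{[0,\tau]}$ for which there exist $X^i,U^i$ such that (a) and (b) hold. Then $\mathcal{U}_c(x_0,u_d)$ is the set of all $u_c:[0,\ell\tau]\to\mathbb{R}^m$ such that for every $i\in\llbracket 0,\ell-1\rrbracket$ there exists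 $u_c^i\in\mathcal{U}_c^i(x_0,u_d)$ with $u_c(i\tau+t)=u_c^i(t)$ for all $t\in[0,\tau]$. Norms and distances: $|x|=(x^\top x)^{1/2}$, and for a positive (semi-)definite matrix $M$, $|x|_M=(x^\top Mx)^{1/2}$. For $z^*\in\mathbb{R}^n$ and $\pi,\pi'\subset\mathbb{R}^n$, $\operatorname{d}(z^*,\pi)=\inf_{z\in\pi}|z^*-z|$ and $\operatorname{dH}(\pi,\pi')=\max\{\sup_{z\in\pi}\operatorname{d}(z,\pi'),\ \sup_{z'\in\pi'}\operatorname{d}(z',\pi)\}$ (Hausdorff distance, possibly $+\infty$). The weight matrix: $W_N^\tau\in\mathbb{R}^{nN\times nN}$ is block diagonal with $j$-th diagonal block $\frac{\tau-t_{N,j}}{|\mathfrak{L}_N^\tau(t_{N,j})|^2}I_n$, $j=1,\dots,N$, and $$\Delta_N^\tau(A_c,B_c)=\begin{bmatrix}I_N\otimes A_c & I_N\otimes B_c\end{bmatrix}^\top W_N^\tau\begin{bmatrix}I_N\otimes A_c & I_N\otimes B_c\end{bmatrix}.$$ *)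

theory Defs
  imports
    "HOL-Analysis.Analysis"
    "Jordan_Normal_Form.Matrix"
begin

text \<open>
  Vectors and matrices are those of \<open>Jordan_Normal_Form.Matrix\<close>, so that all dimensions are
  natural numbers. Rows and columns are numbered from 0 there: column \<open>j\<close> of a matrix
  \<open>[U\<^sub>1 \<dots> U\<^sub>N]\<close> is \<open>U\<^sub>j\<^sub>+\<^sub>1\<close>, and likewise for every matrix below that is indexed by the nodes
  \<open>1, \<dots>, N\<close>.

  A function on \<open>[0, T]\<close> (or on \<open>{0, \<dots>, l}\<close>) is represented by a total function; its values
  outside that set are never used.
\<close>

unbundle no vec_syntax
unbundle no inner_syntax

section \<open>Matrix operations\<close>

definition append_cols :: "'a :: zero Matrix.mat \<Rightarrow> 'a Matrix.mat \<Rightarrow> 'a Matrix.mat"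
    (infixr \<open>@\<^sub>c\<close> 66) where
  "A @\<^sub>c B = four_block_mat A B (0\<^sub>m 0 (dim_col A)) (0\<^sub>m 0 (dim_col B))"

definition kron :: "real Matrix.mat \<Rightarrow> real Matrix.mat \<Rightarrow> real Matrix.mat" where
  "kron A B = Matrix.mat (dim_row A * dim_row B) (dim_col A * dim_col B)
     (\<lambda>(i, j). A $$ (i div dim_row B, j div dim_col B) * B $$ (i mod dim_row B, j mod dim_col B))"

definition kron_sum :: "real Matrix.mat \<Rightarrow> real Matrix.mat \<Rightarrow> real Matrix.mat" where
  "kron_sum A B = kron A (1\<^sub>m (dim_row B)) + kron (1\<^sub>m (dim_row A)) B"

definition vec_of_cols :: "real Matrix.mat \<Rightarrow> real Matrix.vec" where
  "vec_of_cols X = Matrix.vec (dim_col X * dim_row X)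
     (\<lambda>i. X $$ (i mod dim_row X, i div dim_row X))"

definition vnorm :: "real Matrix.vec \<Rightarrow> real" where
  "vnorm x = sqrt (x \<bullet> x)"

definition wnorm :: "real Matrix.mat \<Rightarrow> real Matrix.vec \<Rightarrow> real" where
  "wnorm M x = sqrt (x \<bullet> (M *\<^sub>v x))"

section \<open>Distances\<close>

text \<open>In \<open>ennreal\<close> the infimum of the empty set is \<open>\<infinity>\<close> and its supremum is 0.\<close>

definition pt_dist :: "real Matrix.vec \<Rightarrow> real Matrix.vec set \<Rightarrow> ennreal" where
  "pt_dist z P = (INF y\<in>P. ennreal (vnorm (z - y)))"

definition hausdorff_dist :: "real Matrix.vec set \<Rightarrow> real Matrix.vec set \<Rightarrow> ennreal" where
  "hausdorff_dist P Q = max (SUP z\<in>P. pt_dist z Q) (SUP z\<in>Q. pt_dist z P)"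

section \<open>Trajectories\<close>

text \<open>
  Solutions of \<open>x' = A x + B u\<close> on \<open>[0, T]\<close> are classical ones, the derivative being taken
  componentwise and one-sided at the end points. All inputs to which this is applied are
  continuous on the interval in question, so that such a solution exists and is unique.
\<close>

definition ct_solution ::
  "real Matrix.mat \<Rightarrow> real Matrix.mat \<Rightarrow> real Matrix.vec \<Rightarrow> (real \<Rightarrow> real Matrix.vec) \<Rightarrow> real
   \<Rightarrow> (real \<Rightarrow> real Matrix.vec) \<Rightarrow> bool" where
  "ct_solution A B x0 u T x \<longleftrightarrow>
     x 0 = x0 \<and>
     (\<forall>s\<in>{0..T}. x s \<in> carrier_vec (dim_row A) \<and>
       (\<forall>k<dim_row A. ((\<lambda>r. x r $ k) has_real_derivative (A *\<^sub>v x s + B *\<^sub>v u s) $ k)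
          (at s within {0..T})))"

definition ct_traj ::
  "real Matrix.mat \<Rightarrow> real Matrix.mat \<Rightarrow> real Matrix.vec \<Rightarrow> (real \<Rightarrow> real Matrix.vec) \<Rightarrow> real
   \<Rightarrow> real Matrix.vec" where
  "ct_traj A B x0 u t = (THE v. \<exists>x. ct_solution A B x0 u t x \<and> v = x t)"

primrec dt_traj ::
  "real Matrix.mat \<Rightarrow> real Matrix.mat \<Rightarrow> real Matrix.vec \<Rightarrow> (nat \<Rightarrow> real Matrix.vec) \<Rightarrow> nat
   \<Rightarrow> real Matrix.vec" where
  "dt_traj A B x0 u 0 = x0"
| "dt_traj A B x0 u (Suc i) = A *\<^sub>v dt_traj A B x0 u i + B *\<^sub>v u i"

section \<open>Interpolation\<close>

definition vpoly_on :: "nat \<Rightarrow> nat \<Rightarrow> real set \<Rightarrow> (real \<Rightarrow> real Matrix.vec) set" where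
  "vpoly_on N p I = {f. \<exists>q :: nat \<Rightarrow> real poly. (\<forall>k<p. degree (q k) \<le> N) \<and>
     (\<forall>t\<in>I. f t = Matrix.vec p (\<lambda>k. poly (q k) t))}"

definition interpolations ::
  "nat \<Rightarrow> real \<Rightarrow> nat \<Rightarrow> nat \<Rightarrow> (nat \<Rightarrow> real Matrix.vec) \<Rightarrow> (real \<Rightarrow> real Matrix.vec) set" where
  "interpolations N \<tau> p l sd = {sc. \<exists>P :: nat \<Rightarrow> real \<Rightarrow> real Matrix.vec. \<forall>i<l.
     P i \<in> vpoly_on N p {0..\<tau>} \<and>
     sc (real i * \<tau>) = sd i \<and> sc (real (i + 1) * \<tau>) = sd (i + 1) \<and>
     (\<forall>t\<in>{0..\<tau>}. sc (real i * \<tau> + t) = P i t)}"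

definition interpolator ::
  "nat \<Rightarrow> real \<Rightarrow> real Matrix.mat \<Rightarrow> real Matrix.mat \<Rightarrow> real Matrix.mat \<Rightarrow> real Matrix.mat \<Rightarrow> bool"
  where
  "interpolator N \<tau> Ac Bc Ad Bd \<longleftrightarrow>
     (\<forall>l>0. \<forall>x0\<in>carrier_vec (dim_row Ac). \<forall>ud\<in>{0..l} \<rightarrow> carrier_vec (dim_col Bc).
       \<exists>uc\<in>interpolations N \<tau> (dim_col Bc) l ud.
         ct_traj Ac Bc x0 uc \<in> interpolations N \<tau> (dim_row Ac) l (dt_traj Ad Bd x0 ud))"

section \<open>Quadrature nodes and Lagrange basis\<close>

definition legendre :: "nat \<Rightarrow> real poly" where
  "legendre k = Polynomial.smult (1 / 2 ^ k) (\<Sum>i\<le>k div 2.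
     monom ((- 1) ^ i * real (k choose i) * real ((2 * k - 2 * i) choose k)) (k - 2 * i))"

definition shifted_legendre :: "real \<Rightarrow> nat \<Rightarrow> real poly" where
  "shifted_legendre \<tau> k = pcompose (legendre k) [:- 1, 2 / \<tau>:]"

definition qnode :: "real \<Rightarrow> nat \<Rightarrow> nat \<Rightarrow> real" where
  "qnode \<tau> N j =
     sorted_list_of_set {t. poly (shifted_legendre \<tau> N + shifted_legendre \<tau> (N + 1)) t = 0} ! j"

definition lagrange :: "real \<Rightarrow> nat \<Rightarrow> nat \<Rightarrow> real poly" where
  "lagrange \<tau> N i = (\<Prod>j\<in>{0..N} - {i}.
     Polynomial.smult (1 / (qnode \<tau> N i - qnode \<tau> N j)) [:- qnode \<tau> N j, 1:])"

definition Phi_mat :: "real \<Rightarrow> nat \<Rightarrow> real Matrix.mat" where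
  "Phi_mat \<tau> N = Matrix.mat N 1 (\<lambda>(i, _). poly (lagrange \<tau> N (i + 1)) \<tau>)"

definition psi_mat :: "real \<Rightarrow> nat \<Rightarrow> nat \<Rightarrow> real Matrix.mat" where
  "psi_mat \<tau> N j = Matrix.mat N 1 (\<lambda>(i, _). poly (pderiv (lagrange \<tau> N (i + 1))) (qnode \<tau> N j))"

definition Psi_mat :: "real \<Rightarrow> nat \<Rightarrow> real Matrix.mat" where
  "Psi_mat \<tau> N = Matrix.mat N N (\<lambda>(i, j). psi_mat \<tau> N (j + 1) $$ (i, 0))"

definition sigma_mat :: "real \<Rightarrow> nat \<Rightarrow> real Matrix.mat" where
  "sigma_mat \<tau> N = Matrix.mat 1 N (\<lambda>(_, j). poly (pderiv (lagrange \<tau> N 0)) (qnode \<tau> N (j + 1)))"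

section \<open>The interpolating inputs\<close>

definition step_lhs_mat ::
  "real \<Rightarrow> nat \<Rightarrow> real Matrix.mat \<Rightarrow> real Matrix.mat \<Rightarrow> real Matrix.mat" where
  "step_lhs_mat \<tau> N Ac Bc =
     (let n = dim_row Ac; m = dim_col Bc in
        (kron (psi_mat \<tau> N 0)\<^sup>T (1\<^sub>m n)      @\<^sub>c 0\<^sub>m n (N * m))
     @\<^sub>r (kron_sum (Psi_mat \<tau> N)\<^sup>T (- Ac)    @\<^sub>c - kron (1\<^sub>m N) Bc)
     @\<^sub>r (kron (Phi_mat \<tau> N)\<^sup>T (1\<^sub>m n)        @\<^sub>c 0\<^sub>m n (N * m))
     @\<^sub>r (0\<^sub>m m (N * n)                    @\<^sub>c kron (Phi_mat \<tau> N)\<^sup>T (1\<^sub>m m)))"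

definition step_rhs_mat ::
  "real \<Rightarrow> nat \<Rightarrow> real Matrix.mat \<Rightarrow> real Matrix.mat \<Rightarrow> real Matrix.mat \<Rightarrow> real Matrix.mat
   \<Rightarrow> real Matrix.mat" where
  "step_rhs_mat \<tau> N Ac Bc Ad Bd =
     (let n = dim_row Ac; m = dim_col Bc;
          a = poly (pderiv (lagrange \<tau> N 0)) 0; b = poly (lagrange \<tau> N 0) \<tau> in
        ((Ac - a \<cdot>\<^sub>m 1\<^sub>m n)                 @\<^sub>c Bc                @\<^sub>c 0\<^sub>m n m)
     @\<^sub>r (- kron (sigma_mat \<tau> N)\<^sup>T (1\<^sub>m n)   @\<^sub>c 0\<^sub>m (N * n) m     @\<^sub>c 0\<^sub>m (N * n) m)
     @\<^sub>r ((Ad - b \<cdot>\<^sub>m 1\<^sub>m n)                 @\<^sub>c Bd                @\<^sub>c 0\<^sub>m n m)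
     @\<^sub>r (0\<^sub>m m n                          @\<^sub>c - (b \<cdot>\<^sub>m 1\<^sub>m m)     @\<^sub>c 1\<^sub>m m))"

definition step_equation ::
  "real \<Rightarrow> nat \<Rightarrow> real Matrix.mat \<Rightarrow> real Matrix.mat \<Rightarrow> real Matrix.mat \<Rightarrow> real Matrix.mat
   \<Rightarrow> real Matrix.vec \<Rightarrow> (nat \<Rightarrow> real Matrix.vec) \<Rightarrow> nat
   \<Rightarrow> real Matrix.mat \<Rightarrow> real Matrix.mat \<Rightarrow> bool" where
  "step_equation \<tau> N Ac Bc Ad Bd x0 ud i X U \<longleftrightarrow>
     step_lhs_mat \<tau> N Ac Bc *\<^sub>v (vec_of_cols X @\<^sub>v vec_of_cols U) =
     step_rhs_mat \<tau> N Ac Bc Ad Bd *\<^sub>v (dt_traj Ad Bd x0 ud i @\<^sub>v ud i @\<^sub>v ud (i + 1))"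

definition step_input ::
  "real \<Rightarrow> nat \<Rightarrow> (nat \<Rightarrow> real Matrix.vec) \<Rightarrow> nat \<Rightarrow> real Matrix.mat
   \<Rightarrow> (real \<Rightarrow> real Matrix.vec) \<Rightarrow> bool" where
  "step_input \<tau> N ud i U uci \<longleftrightarrow>
     (\<forall>t\<in>{0..\<tau>}. uci t = Matrix.vec (dim_row U) (\<lambda>k.
        poly (lagrange \<tau> N 0) t * ud i $ k +
        (\<Sum>j=1..N. poly (lagrange \<tau> N j) t * Matrix.col U (j - 1) $ k)))"

definition step_input_set ::
  "real \<Rightarrow> nat \<Rightarrow> real Matrix.mat \<Rightarrow> real Matrix.mat \<Rightarrow> real Matrix.mat \<Rightarrow> real Matrix.mat
   \<Rightarrow> real Matrix.vec \<Rightarrow> (nat \<Rightarrow> real Matrix.vec) \<Rightarrow> nat \<Rightarrow> (real \<Rightarrow> real Matrix.vec) set" where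
  "step_input_set \<tau> N Ac Bc Ad Bd x0 ud i = {uci \<in> vpoly_on N (dim_col Bc) {0..\<tau>}.
     \<exists>X\<in>carrier_mat (dim_row Ac) N. \<exists>U\<in>carrier_mat (dim_col Bc) N.
       step_equation \<tau> N Ac Bc Ad Bd x0 ud i X U \<and> step_input \<tau> N ud i U uci}"

definition input_set ::
  "real \<Rightarrow> nat \<Rightarrow> real Matrix.mat \<Rightarrow> real Matrix.mat \<Rightarrow> real Matrix.mat \<Rightarrow> real Matrix.mat
   \<Rightarrow> nat \<Rightarrow> real Matrix.vec \<Rightarrow> (nat \<Rightarrow> real Matrix.vec) \<Rightarrow> (real \<Rightarrow> real Matrix.vec) set" where
  "input_set \<tau> N Ac Bc Ad Bd l x0 ud = {uc. \<forall>i<l.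
     \<exists>uci\<in>step_input_set \<tau> N Ac Bc Ad Bd x0 ud i. \<forall>t\<in>{0..\<tau>}. uc (real i * \<tau> + t) = uci t}"

section \<open>The weight matrices\<close>

definition W_mat :: "real \<Rightarrow> nat \<Rightarrow> nat \<Rightarrow> real Matrix.mat" where
  "W_mat \<tau> N n = diag_block_mat (map (\<lambda>j.
     ((\<tau> - qnode \<tau> N j) / \<bar>poly (shifted_legendre \<tau> N) (qnode \<tau> N j)\<bar>\<^sup>2) \<cdot>\<^sub>m 1\<^sub>m n) [1..<N + 1])"

definition Delta_mat ::
  "real \<Rightarrow> nat \<Rightarrow> real Matrix.mat \<Rightarrow> real Matrix.mat \<Rightarrow> real Matrix.mat" where
  "Delta_mat \<tau> N Ac Bc =
     (let G = kron (1\<^sub>m N) Ac @\<^sub>c kron (1\<^sub>m N) Bc in G\<^sup>T * W_mat \<tau> N (dim_row Ac) * G)"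

end

theory Submission
  imports Defs
begin

text \<open>
  On each sampling interval the Lagrange interpolant \<open>x\<close> of \<open>x\<^sub>d(i)\<close> and the columns of \<open>X\<close> satisfies the
  differential equation at the \<open>N + 1\<close> nodes; as all terms have degree at most \<open>N\<close>, it is the exact
  trajectory, with \<open>x(0) = x\<^sub>d(i)\<close> and \<open>x(\<tau>) = x\<^sub>d(i + 1)\<close>. By Cauchy--Schwarz, for \<open>s, t\<close> in \<open>[0, \<tau>]\<close>,
  \<open>|x(s) - x(t)|\<^sup>2 \<le> \<tau> \<integral> |x'|\<^sup>2\<close>. The nodes are the left Radau points, so the quadrature with weights
  \<open>\<tau> / (N + 1)\<^sup>2\<close> at \<open>0\<close> and \<open>(\<tau> - t\<^sub>j) / ((N + 1) L\<^sub>N(t\<^sub>j))\<^sup>2\<close> at \<open>t\<^sub>j\<close> integrates \<open>|x'|\<^sup>2\<close> exactly, and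
  \<open>x'(0)\<close> and \<open>x'(t\<^sub>j)\<close> are the vectors whose norms appear on the right-hand side. This gives the bound even
  without the factors \<open>sqrt 6 * N\<close>. Taking \<open>s = 0\<close> and \<open>s = \<tau>\<close> compares \<open>x(t)\<close> with \<open>\<pi>\<^sub>i\<close> and \<open>\<pi>\<^sub>i\<^sub>+\<^sub>1\<close>.
\<close>

section \<open>Iterated derivatives of polynomials\<close>

lemma higher_pderiv_monom_real:
  fixes c :: real
  assumes "k \<le> m"
  shows "(pderiv ^^ k) (monom c m) = monom (pochhammer (real (m - k) + 1) k * c) (m - k)"
proof (rule poly_eqI)
  fix j
  show "poly.coeff ((pderiv ^^ k) (monom c m)) j
      = poly.coeff (monom (pochhammer (real (m - k) + 1) k * c) (m - k)) j"
    using assms by (auto simp: coeff_higher_pderiv add.commute)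
qed

lemma higher_pderiv_eq_0:
  fixes p :: "real poly"
  assumes "\<And>j. k \<le> j \<Longrightarrow> poly.coeff p j = 0"
  shows "(pderiv ^^ k) p = 0"
  by (rule poly_eqI) (simp add: coeff_higher_pderiv assms)

text \<open>Rodrigues' formula: expand \<open>(x^2 - 1)^k\<close> binomially and differentiate
  termwise. As a \<open>k\<close>-th derivative of a polynomial with zeros of order \<open>k\<close>
  at both ends of [-1, 1], the Legendre polynomial becomes accessible to integration by parts,
  Rolle's theorem and evaluation at the end points.\<close>

lemma legendre_rodrigues:
  "legendre k = Polynomial.smult (1 / (2 ^ k * fact k)) ((pderiv ^^ k) ([:- 1, 0, 1:] ^ k))"
proof -
  have base: "[:- 1, 0, 1:] = [:- 1:] + monom (1::real) 2"
    by (simp add: numeral_2_eq_2 monom_Suc one_pCons)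
  have const_pow: "[:- 1:] ^ i = [:(- 1) ^ i :: real:]" for i
    by (induction i) (auto simp: one_pCons)
  have "[:- 1, 0, 1:] ^ k = (\<Sum>i\<le>k. monom ((- 1) ^ i * real (k choose i)) (2 * k - 2 * i))"
    unfolding base binomial_ring
  proof (rule sum.cong[OF refl])
    fix i
    show "of_nat (k choose i) * [:- 1:] ^ i * monom (1::real) 2 ^ (k - i)
        = monom ((- 1) ^ i * real (k choose i)) (2 * k - 2 * i)"
      by (simp add: const_pow monom_power of_nat_poly smult_monom diff_mult_distrib mult.commute)
  qed
  then have "(pderiv ^^ k) ([:- 1, 0, 1:] ^ k)
      = (\<Sum>i\<le>k. (pderiv ^^ k) (monom ((- 1) ^ i * real (k choose i)) (2 * k - 2 * i)))"
    by (simp add: higher_pderiv_sum)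
  \<comment> \<open>For \<open>2 * i > k\<close> the monomial has degree
    \<open>2 * k - 2 * i < k\<close>, so \<open>k\<close> differentiations annihilate it.\<close>
  also have "\<dots> = (\<Sum>i\<le>k div 2. (pderiv ^^ k) (monom ((- 1) ^ i * real (k choose i)) (2 * k - 2 * i)))"
  proof (rule sum.mono_neutral_right)
    show "\<forall>i\<in>{..k} - {..k div 2}.
        (pderiv ^^ k) (monom ((- 1) ^ i * real (k choose i)) (2 * k - 2 * i)) = 0"
      by (intro ballI higher_pderiv_eq_0) auto
  qed auto
  also have "\<dots> = (\<Sum>i\<le>k div 2. Polynomial.smult (fact k)
      (monom ((- 1) ^ i * real (k choose i) * real ((2 * k - 2 * i) choose k)) (k - 2 * i)))"
  proof (rule sum.cong[OF refl])
    fix i assume "i \<in> {..k div 2}"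
    then have i: "2 * i \<le> k" by auto
    have "real ((2 * k - 2 * i) choose k) * fact k = pochhammer (real (2 * k - 2 * i - k) + 1) k"
      using i by (simp add: binomial_gbinomial gbinomial_pochhammer' of_nat_diff)
    then show "(pderiv ^^ k) (monom ((- 1) ^ i * real (k choose i)) (2 * k - 2 * i)) =
        Polynomial.smult (fact k)
          (monom ((- 1) ^ i * real (k choose i) * real ((2 * k - 2 * i) choose k)) (k - 2 * i))"
      using i by (simp add: higher_pderiv_monom_real smult_monom mult_ac)
  qed
  also have "\<dots> = Polynomial.smult (fact k) (\<Sum>i\<le>k div 2.
      monom ((- 1) ^ i * real (k choose i) * real ((2 * k - 2 * i) choose k)) (k - 2 * i))"
    by (rule poly_eqI) (simp add: coeff_sum sum_distrib_left)
  finally show ?thesis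
    by (simp add: legendre_def)
qed

text \<open>Leibniz rule with only two surviving terms, since the second derivative of a linear
  factor vanishes.\<close>

lemma higher_pderiv_linear_mult:
  fixes h :: "real poly"
  shows "(pderiv ^^ Suc k) ([:a, 1:] * h)
    = [:a, 1:] * (pderiv ^^ Suc k) h + Polynomial.smult (real (Suc k)) ((pderiv ^^ k) h)"
proof (induction k arbitrary: h)
  case 0
  show ?case by (simp add: pderiv_mult pderiv_pCons del: mult_pCons_left)
next
  case (Suc k)
  have "(pderiv ^^ Suc (Suc k)) ([:a, 1:] * h) = pderiv ((pderiv ^^ Suc k) ([:a, 1:] * h))"
    by simp
  also have "\<dots> = pderiv ([:a, 1:] * (pderiv ^^ Suc k) h + Polynomial.smult (real (Suc k)) ((pderiv ^^ k) h))"
    by (simp only: Suc)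
  also have "\<dots> = [:a, 1:] * (pderiv ^^ Suc (Suc k)) h
      + Polynomial.smult (real (Suc (Suc k))) ((pderiv ^^ Suc k) h)"
    by (simp add: pderiv_add pderiv_mult pderiv_smult pderiv_pCons smult_add_left del: mult_pCons_left)
      (simp add: numeral_poly)
  finally show ?case .
qed

lemma poly_higher_pderiv_root:
  fixes h :: "real poly"
  assumes "[:- a, 1:] ^ n dvd h" "k < n"
  shows "poly ((pderiv ^^ k) h) a = 0"
  using assms
proof (induction k arbitrary: h n)
  case 0
  then have "[:- a, 1:] dvd h"
    by (meson dvd_power dvd_trans)
  then show ?case by (simp add: poly_eq_0_iff_dvd)
next
  case (Suc k)
  then obtain n' where n: "n = Suc n'" by (cases n) auto
  from Suc.prems obtain g where h: "h = [:- a, 1:] ^ n * g" by (auto simp: dvd_def)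
  have "pderiv h = [:- a, 1:] ^ n' * (Polynomial.smult (real n) g + [:- a, 1:] * pderiv g)"
    unfolding h n by (simp add: pderiv_mult pderiv_power_Suc pderiv_pCons algebra_simps del: power_Suc)
      (simp add: algebra_simps)
  then have "[:- a, 1:] ^ n' dvd pderiv h" by simp
  then show ?case using Suc.IH[of n' "pderiv h"] Suc.prems n
    by (simp add: funpow_Suc_right del: funpow.simps)
qed

text \<open>In the Leibniz expansion every term but one keeps a factor \<open>[:- a, 1:]\<close>;
  the remaining one has all \<open>n\<close> derivatives on the power. This yields the end point
  values of the Legendre polynomials.\<close>

lemma poly_higher_pderiv_power:
  fixes h :: "real poly"
  shows "poly ((pderiv ^^ n) ([:- a, 1:] ^ n * h)) a = fact n * poly h a"
proof (induction n arbitrary: h)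
  case (Suc n)
  have "pderiv ([:- a, 1:] ^ Suc n * h)
      = [:- a, 1:] ^ n * (Polynomial.smult (real (Suc n)) h + [:- a, 1:] * pderiv h)"
    by (simp add: pderiv_mult pderiv_power_Suc pderiv_pCons algebra_simps del: power_Suc)
      (simp add: algebra_simps)
  then show ?case
    using Suc[of "Polynomial.smult (real (Suc n)) h + [:- a, 1:] * pderiv h"]
    by (simp add: funpow_Suc_right del: funpow.simps power_Suc)
qed simp

section \<open>Integration by parts and Rolle's theorem for polynomials\<close>

lemma has_integral_pderiv:
  fixes p :: "real poly"
  assumes "a \<le> b"
  shows "(poly (pderiv p) has_integral poly p b - poly p a) {a..b}"
  by (rule fundamental_theorem_of_calculus[OF assms])
     (auto simp: has_real_derivative_iff_has_vector_derivative[symmetric]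
        intro: has_field_derivative_at_within poly_DERIV)

lemma integrable_poly: "(poly p :: real \<Rightarrow> real) integrable_on {a..b}"
  by (intro integrable_continuous_interval continuous_intros)

text \<open>Integration by parts, with no boundary terms because \<open>h\<close> vanishes to order \<open>n\<close> at both ends.\<close>

lemma integral_higher_pderiv_eq_0:
  fixes h f :: "real poly"
  assumes "a \<le> b"
    and "\<And>k. k < n \<Longrightarrow> poly ((pderiv ^^ k) h) a = 0"
    and "\<And>k. k < n \<Longrightarrow> poly ((pderiv ^^ k) h) b = 0"
    and "(pderiv ^^ n) f = 0"
  shows "integral {a..b} (poly (f * (pderiv ^^ n) h)) = 0"
  using assms
proof (induction n arbitrary: f)
  case (Suc n)
  have "((poly (pderiv (f * (pderiv ^^ n) h))) has_integral 0) {a..b}"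
    using has_integral_pderiv[OF \<open>a \<le> b\<close>, of "f * (pderiv ^^ n) h"] Suc.prems(2,3)[of n] by simp
  then have "integral {a..b} (poly (pderiv (f * (pderiv ^^ n) h))) = 0"
    by (rule integral_unique)
  moreover have "poly (pderiv (f * (pderiv ^^ n) h))
      = (\<lambda>x. poly (f * (pderiv ^^ Suc n) h) x + poly (pderiv f * (pderiv ^^ n) h) x)"
    by (auto simp: pderiv_mult algebra_simps)
  moreover have "integral {a..b} (poly (pderiv f * (pderiv ^^ n) h)) = 0"
    by (rule Suc.IH) (use Suc.prems in \<open>simp_all add: funpow_Suc_right del: funpow.simps\<close>)
  ultimately show ?case
    by (simp add: integral_add[OF integrable_poly integrable_poly] del: poly_mult funpow.simps)
qed (simp add: integral_0[unfolded fun_eq_iff] cong: integral_cong)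

text \<open>Rolle's theorem in each gap between neighbouring zeros. Points are added in increasing
  order, so a new gap lies to the right of all zeros found before.\<close>

lemma rolle_finite_set:
  fixes p :: "real poly"
  assumes "finite S" "S \<noteq> {}" "\<And>x. x \<in> S \<Longrightarrow> poly p x = 0"
  shows "\<exists>T. finite T \<and> Suc (card T) = card S \<and> T \<subseteq> {Min S<..<Max S} \<and> (\<forall>x\<in>T. poly (pderiv p) x = 0)"
  using assms
proof (induction S rule: finite_linorder_max_induct)
  case (insert b S)
  show ?case
  proof (cases "S = {}")
    case True
    then show ?thesis by (intro exI[of _ "{}"]) auto
  next
    case False
    with insert obtain T where T: "finite T" "Suc (card T) = card S" "T \<subseteq> {Min S<..<Max S}"
      "\<forall>x\<in>T. poly (pderiv p) x = 0" by auto
    have "Max S \<in> S" "Max S < b" using insert False by auto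
    have "\<exists>z. Max S < z \<and> z < b \<and> DERIV (poly p) z :> 0"
      using \<open>Max S \<in> S\<close> \<open>Max S < b\<close> insert.prems
      by (intro Rolle) (auto intro: continuous_intros poly_differentiable)
    then obtain z where z: "Max S < z" "z < b" "poly (pderiv p) z = 0"
      using DERIV_unique[OF poly_DERIV] by blast
    have mm: "Min (insert b S) = Min S" "Max (insert b S) = b"
      unfolding Min_insert[OF \<open>finite S\<close> False] Max_insert[OF \<open>finite S\<close> False]
      using \<open>Max S < b\<close> Min_le[OF \<open>finite S\<close> \<open>Max S \<in> S\<close>] by linarith+
    have "z \<notin> T" "b \<notin> S" using T z insert by auto
    moreover have "Min S < z" using z \<open>Max S \<in> S\<close> Min_le[OF \<open>finite S\<close>, of "Max S"] by linarith
    ultimately show ?thesis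
      using T z insert \<open>Max S < b\<close> unfolding mm
      by (intro exI[of _ "insert z T"]) auto
  qed
qed simp

text \<open>As long as fewer than \<open>n\<close> derivatives have been taken, both end points are
  zeros too. Together with \<open>k\<close> interior zeros they make \<open>k + 2\<close>, hence
  \<open>k + 1\<close> interior zeros of the next derivative.\<close>

lemma zeros_higher_pderiv:
  fixes h :: "real poly"
  assumes "a < b"
    and "\<And>k. k < n \<Longrightarrow> poly ((pderiv ^^ k) h) a = 0"
    and "\<And>k. k < n \<Longrightarrow> poly ((pderiv ^^ k) h) b = 0"
  shows "\<exists>T. finite T \<and> card T = n \<and> T \<subseteq> {a<..<b} \<and> (\<forall>x\<in>T. poly ((pderiv ^^ n) h) x = 0)"
  using assms(2,3)
proof (induction n)
  case (Suc n)
  then obtain T where T: "finite T" "card T = n" "T \<subseteq> {a<..<b}" "\<forall>x\<in>T. poly ((pderiv ^^ n) h) x = 0"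
    by auto
  let ?S = "insert a (insert b T)"
  have card: "card ?S = Suc (Suc n)"
  proof -
    have "a \<notin> insert b T" "b \<notin> T" using T \<open>a < b\<close> by auto
    then show ?thesis using T by simp
  qed
  have "Min ?S = a" "Max ?S = b"
  proof -
    show "Min ?S = a"
      by (rule Min_eqI) (use T \<open>a < b\<close> in auto)
    show "Max ?S = b"
      by (rule Max_eqI) (use T \<open>a < b\<close> in auto)
  qed
  then show ?case
    using rolle_finite_set[of ?S "(pderiv ^^ n) h"] T Suc.prems[of n] card by auto
qed auto

section \<open>Radau quadrature\<close>

lemma degree_legendre: "Polynomial.degree (legendre k) \<le> k"
proof -
  have "Polynomial.degree (\<Sum>i\<le>k div 2. monom ((- 1) ^ i * real (k choose i)
      * real ((2 * k - 2 * i) choose k)) (k - 2 * i)) \<le> k"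
    by (intro degree_sum_le) (auto intro: order.trans[OF degree_monom_le])
  then show ?thesis
    unfolding legendre_def using degree_smult_le order.trans by blast
qed

text \<open>Carrying out one of the \<open>k + 1\<close> differentiations leaves as many as in the
  formula for \<open>legendre k\<close>, so that the two can be added.\<close>

lemma legendre_Suc_rodrigues:
  "legendre (Suc k) = Polynomial.smult (1 / (2 ^ k * fact k))
     ((pderiv ^^ k) ([:0, 1:] * [:- 1, 0, 1:] ^ k))"
proof -
  have "pderiv ([:- 1, 0, 1:] ^ Suc k)
      = Polynomial.smult (2 * real (Suc k)) ([:0, 1:] * [:- 1, 0, 1:] ^ k)"
    unfolding pderiv_power_Suc by (simp add: pderiv_pCons mult.commute del: power_Suc)
  then have "(pderiv ^^ Suc k) ([:- 1, 0, 1:] ^ Suc k)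
      = Polynomial.smult (2 * real (Suc k)) ((pderiv ^^ k) ([:0, 1:] * [:- 1, 0, 1:] ^ k))"
    by (simp only: funpow_Suc_right o_apply higher_pderiv_smult)
  moreover have "1 / (2 ^ Suc k * fact (Suc k)) * (2 * real (Suc k)) = 1 / (2 ^ k * fact k)"
    by (simp add: divide_simps)
  ultimately show ?thesis
    by (simp only: legendre_rodrigues smult_smult)
qed

text \<open>The node polynomial on the reference interval [-1, 1]; the nodes \<open>qnode\<close>
  are affine images of its zeros.\<close>

definition radau_poly :: "nat \<Rightarrow> real poly" where
  "radau_poly N = legendre N + legendre (Suc N)"

text \<open>The factors \<open>1\<close> and \<open>x\<close> of the two formulas add up to
  \<open>1 + x\<close>. The polynomial under the derivatives therefore vanishes to order
  \<open>N + 1\<close> at -1 but only \<open>N\<close> at 1: the source of the node at the left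
  end.\<close>

lemma radau_poly_rodrigues:
  "radau_poly N = Polynomial.smult (1 / (2 ^ N * fact N))
     ((pderiv ^^ N) ([:1, 1:] * [:- 1, 0, 1:] ^ N))"
proof -
  have "[:1, 1:] * p = p + [:0, 1:] * p" for p :: "real poly"
    by simp
  then show ?thesis
    unfolding radau_poly_def legendre_Suc_rodrigues legendre_rodrigues[of N]
    by (simp only: higher_pderiv_add smult_add_right)
qed

lemma degree_radau_poly: "Polynomial.degree (radau_poly N) \<le> Suc N"
  unfolding radau_poly_def
  by (intro degree_add_le degree_legendre order.trans[OF degree_legendre]) simp

text \<open>Differentiate \<open>(x - 1) * ((x + 1) * (x^2 - 1)^N) = (x^2 - 1)^(N + 1)\<close>
  \<open>N + 1\<close> times. At a node the two Legendre values are opposite, so the derivative of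
  the node polynomial is expressed by \<open>legendre N\<close>; this is how Legendre values enter
  the weights.\<close>

lemma linear_mult_pderiv_radau_poly:
  "(1 - x) * poly (pderiv (radau_poly N)) x
    = real (Suc N) * (poly (legendre N) x - poly (legendre (Suc N)) x)"
proof -
  let ?h = "[:1, 1:] * [:- 1, 0, 1:] ^ N :: real poly"
  let ?c = "1 / (2 ^ N * fact N) :: real"
  have "[:- 1, 1:] * ?h = [:- 1, 0, 1:] ^ Suc N"
    by simp
  then have "Polynomial.smult ?c ((pderiv ^^ Suc N) ([:- 1, 0, 1:] ^ Suc N))
      = [:- 1, 1:] * Polynomial.smult ?c ((pderiv ^^ Suc N) ?h)
        + Polynomial.smult (real (Suc N)) (Polynomial.smult ?c ((pderiv ^^ N) ?h))"
    using higher_pderiv_linear_mult[of N "- 1" ?h]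
    by (simp only: smult_add_right mult_smult_right smult_smult mult.commute)
  \<comment> \<open>\<open>?c\<close> normalises degree \<open>N\<close>; the constant for degree
    \<open>N + 1\<close> is smaller by the factor \<open>2 * (N + 1)\<close>.\<close>
  moreover have "?c = 2 * real (Suc N) * (1 / (2 ^ Suc N * fact (Suc N)))"
    by (simp add: divide_simps)
  then have "Polynomial.smult ?c ((pderiv ^^ Suc N) ([:- 1, 0, 1:] ^ Suc N))
      = Polynomial.smult (2 * real (Suc N)) (legendre (Suc N))"
    by (simp only: legendre_rodrigues smult_smult)
  moreover have "Polynomial.smult ?c ((pderiv ^^ Suc N) ?h) = pderiv (radau_poly N)"
    by (simp only: radau_poly_rodrigues pderiv_smult funpow.simps o_apply)
  ultimately have "Polynomial.smult (2 * real (Suc N)) (legendre (Suc N))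
      = [:- 1, 1:] * pderiv (radau_poly N) + Polynomial.smult (real (Suc N)) (radau_poly N)"
    by (simp only: radau_poly_rodrigues)
  from arg_cong[OF this, of "\<lambda>p. poly p x"] show ?thesis
    by (simp add: radau_poly_def algebra_simps)
qed

lemma dvd_legendre_base:
  "[:- 1, 1:] ^ N dvd [:- 1, 0, 1 :: real:] ^ N" "[:- (- 1), 1:] ^ N dvd [:- 1, 0, 1 :: real:] ^ N"
proof -
  have "[:- 1, 0, 1 :: real:] = [:- 1, 1:] * [:1, 1:]" by simp
  then show "[:- 1, 1:] ^ N dvd [:- 1, 0, 1 :: real:] ^ N"
    "[:- (- 1), 1:] ^ N dvd [:- 1, 0, 1 :: real:] ^ N"
    by (simp_all only: power_mult_distrib minus_minus) simp_all
qed

text \<open>\<open>N\<close>-fold integration by parts moves all derivatives onto \<open>f\<close>.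
  The condition on coefficients expresses degree below \<open>N\<close> and also covers
  \<open>N = 0\<close>, where it forces \<open>f = 0\<close>.\<close>

lemma legendre_orthogonal:
  assumes "\<And>j. N \<le> j \<Longrightarrow> poly.coeff f j = 0"
  shows "integral {- 1..1} (poly (f * legendre N)) = 0"
proof -
  have "integral {- 1..1} (poly (Polynomial.smult (1 / (2 ^ N * fact N)) f
      * (pderiv ^^ N) ([:- 1, 0, 1:] ^ N))) = 0"
    using dvd_legendre_base[of N]
    by (intro integral_higher_pderiv_eq_0 poly_higher_pderiv_root higher_pderiv_eq_0)
      (auto simp: assms)
  then show ?thesis
    by (simp only: legendre_rodrigues mult_smult_left mult_smult_right)
qed

text \<open>The extra factor \<open>1 + x\<close> preserves the zeros of order \<open>N\<close> at
  both ends, so the argument for \<open>legendre N\<close> carries over.\<close>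

lemma radau_poly_orthogonal:
  assumes "\<And>j. N \<le> j \<Longrightarrow> poly.coeff f j = 0"
  shows "integral {- 1..1} (poly (f * radau_poly N)) = 0"
proof -
  have "integral {- 1..1} (poly (Polynomial.smult (1 / (2 ^ N * fact N)) f
      * (pderiv ^^ N) ([:1, 1:] * [:- 1, 0, 1:] ^ N))) = 0"
    using dvd_mult[OF dvd_legendre_base(1)[of N], of "[:1, 1:]"]
      dvd_mult[OF dvd_legendre_base(2)[of N], of "[:1, 1:]"]
    by (intro integral_higher_pderiv_eq_0 poly_higher_pderiv_root higher_pderiv_eq_0)
      (auto simp: assms)
  then show ?thesis
    by (simp only: radau_poly_rodrigues mult_smult_left mult_smult_right)
qed

lemma poly_legendre_1: "poly (legendre k) 1 = 1"
proof -
  have "[:- 1, 0, 1 :: real:] ^ k = [:- 1, 1:] ^ k * [:1, 1:] ^ k"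
    by (simp add: power_mult_distrib[symmetric])
  then show ?thesis
    using poly_higher_pderiv_power[of k 1 "[:1, 1:] ^ k"]
    by (simp add: legendre_rodrigues)
qed

lemma poly_legendre_minus_1: "poly (legendre k) (- 1) = (- 1) ^ k"
proof -
  have "[:- 1, 0, 1 :: real:] ^ k = [:- (- 1), 1:] ^ k * [:- 1, 1:] ^ k"
    by (simp add: power_mult_distrib[symmetric])
  then show ?thesis
    using poly_higher_pderiv_power[of k "- 1" "[:- 1, 1:] ^ k"]
    by (simp add: legendre_rodrigues power_minus[of "2::real"])
qed

section \<open>Number and location of the nodes\<close>

definition radau_nodes :: "nat \<Rightarrow> real set" where
  "radau_nodes N = {x. poly (radau_poly N) x = 0}"

lemma radau_poly_neq_0: "radau_poly N \<noteq> 0"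
proof
  assume "radau_poly N = 0"
  then have "poly (radau_poly N) 1 = 0" by simp
  then show False by (simp add: radau_poly_def poly_legendre_1)
qed

text \<open>Rolle gives \<open>N\<close> zeros in the open interval; -1 is one more because the
  values of the two Legendre polynomials cancel there. The degree leaves room for no others.\<close>

lemma radau_nodes:
  shows finite_radau_nodes: "finite (radau_nodes N)"
    and card_radau_nodes: "card (radau_nodes N) = Suc N"
    and minus_1_radau_node: "- 1 \<in> radau_nodes N"
    and radau_nodes_subset: "radau_nodes N \<subseteq> {- 1..<1}"
proof -
  let ?h = "[:1, 1:] * [:- 1, 0, 1:] ^ N :: real poly"
  have "\<exists>T. finite T \<and> card T = N \<and> T \<subseteq> {- 1<..<1} \<and> (\<forall>x\<in>T. poly ((pderiv ^^ N) ?h) x = 0)"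
    using dvd_mult[OF dvd_legendre_base(1)[of N], of "[:1, 1:]"]
      dvd_mult[OF dvd_legendre_base(2)[of N], of "[:1, 1:]"]
    by (intro zeros_higher_pderiv poly_higher_pderiv_root) auto
  then obtain T where T: "finite T" "card T = N" "T \<subseteq> {- 1<..<1}"
    "\<forall>x\<in>T. poly (radau_poly N) x = 0"
    unfolding radau_poly_rodrigues by auto
  show fin: "finite (radau_nodes N)"
    unfolding radau_nodes_def by (rule poly_roots_finite[OF radau_poly_neq_0])
  show m1: "- 1 \<in> radau_nodes N"
    by (simp add: radau_nodes_def radau_poly_def poly_legendre_minus_1)
  have sub: "insert (- 1) T \<subseteq> radau_nodes N"
    using m1 T by (auto simp: radau_nodes_def)
  have "- 1 \<notin> T" using T by auto
  then have card_T: "card (insert (- 1) T) = Suc N" using T by simp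
  have "card (radau_nodes N) \<le> Suc N"
    unfolding radau_nodes_def
    using card_poly_roots_bound[OF radau_poly_neq_0[of N]] degree_radau_poly[of N] by linarith
  with card_mono[OF fin sub] card_T show "card (radau_nodes N) = Suc N" by simp
  with card_T sub fin have "radau_nodes N = insert (- 1) T"
    by (metis card_subset_eq)
  then show "radau_nodes N \<subseteq> {- 1..<1}" using T by auto
qed

section \<open>Exactness and weights of the quadrature\<close>

lemma integral_poly_lincomb:
  fixes p r :: "real poly"
  shows "integral {a..b} (poly (p + r)) = integral {a..b} (poly p) + integral {a..b} (poly r)"
    and "integral {a..b} (poly (p - r)) = integral {a..b} (poly p) - integral {a..b} (poly r)"
    and "integral {a..b} (poly (Polynomial.smult c p)) = c * integral {a..b} (poly p)"
proof -
  have *: "poly (p + r) = (\<lambda>x. poly p x + poly r x)" "poly (p - r) = (\<lambda>x. poly p x - poly r x)"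
    "poly (Polynomial.smult c p) = (\<lambda>x. c * poly p x)"
    by auto
  show "integral {a..b} (poly (p + r)) = integral {a..b} (poly p) + integral {a..b} (poly r)"
    unfolding * by (rule integral_add[OF integrable_poly integrable_poly])
  show "integral {a..b} (poly (p - r)) = integral {a..b} (poly p) - integral {a..b} (poly r)"
    unfolding * by (rule integral_diff[OF integrable_poly integrable_poly])
  show "integral {a..b} (poly (Polynomial.smult c p)) = c * integral {a..b} (poly p)"
    unfolding * by simp
qed

lemma integral_poly_sum:
  fixes p :: "'a \<Rightarrow> real poly"
  assumes "finite A"
  shows "integral {a..b} (poly (\<Sum>x\<in>A. p x)) = (\<Sum>x\<in>A. integral {a..b} (poly (p x)))"
  using assms
proof induction
  case empty
  have "poly 0 = (\<lambda>x::real. 0)" by auto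
  then show ?case by simp
qed (simp add: integral_poly_lincomb del: poly_add)

text \<open>
  Exactness holds with the weights \<open>w x = (\<integral> Q x) / q' x\<close>, where \<open>q\<close> is the node polynomial and
  \<open>Q x = q / (X - x)\<close>. They are made explicit by integrating \<open>Q x * L\<close> with \<open>L\<close> the Legendre polynomial
  of degree \<open>N\<close>: all \<open>Q x\<close> have the same leading coefficient, so \<open>w x * q' x * L x = K\<close> for all nodes \<open>x\<close>.
  Integrating \<open>q' * L\<close> by parts gives \<open>(N + 1) * K = 2\<close>.
\<close>

theorem radau_quadrature:
  assumes "Polynomial.degree f \<le> 2 * N"
  shows "integral {- 1..1} (poly f) = (\<Sum>x\<in>radau_nodes N.
    (1 - x) / (real (Suc N) * poly (legendre N) x)\<^sup>2 * poly f x)"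
proof -
  let ?q = "radau_poly N" and ?Z = "radau_nodes N" and ?L = "legendre N"
  let ?I = "\<lambda>p. integral {- 1..1} (poly p :: real \<Rightarrow> real)"
  note fin = finite_radau_nodes[of N] and card = card_radau_nodes[of N]
  have root: "poly ?q x = 0" if "x \<in> ?Z" for x using that by (simp add: radau_nodes_def)
  \<comment> \<open>Divided by \<open>poly (pderiv ?q) x\<close>, the cofactor \<open>Q x\<close> is
    the Lagrange basis polynomial of the node \<open>x\<close>.\<close>
  define Q where "Q x = ?q div [:- x, 1:]" for x
  have Q: "?q = [:- x, 1:] * Q x" if "x \<in> ?Z" for x
    using root[OF that] by (simp add: Q_def poly_eq_0_iff_dvd del: mult_pCons_left)
  have deg_Q: "Polynomial.degree (Q x) \<le> N" if "x \<in> ?Z" for x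
    using degree_mult_eq[of "[:- x, 1:]" "Q x"] Q[OF that] degree_radau_poly[of N] radau_poly_neq_0[of N]
    by (cases "Q x = 0") auto
  have Q_other: "poly (Q x) y = 0" if "x \<in> ?Z" "y \<in> ?Z" "x \<noteq> y" for x y
  proof -
    have "(y - x) * poly (Q x) y = 0"
      using root[OF that(2)] arg_cong[OF Q[OF that(1)], of "\<lambda>p. poly p y"] by (simp add: algebra_simps)
    then show ?thesis using that by simp
  qed
  have Q_self: "poly (Q x) x = poly (pderiv ?q) x" if "x \<in> ?Z" for x
    using arg_cong[OF Q[OF that], of "\<lambda>p. poly (pderiv p) x"]
    by (simp add: pderiv_mult pderiv_pCons del: mult_pCons_left)
  \<comment> \<open>A double zero at \<open>x\<close> would make \<open>Q x\<close>, of degree at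
    most \<open>N\<close>, vanish at all \<open>N + 1\<close> nodes.\<close>
  have simple: "poly (pderiv ?q) x \<noteq> 0" if "x \<in> ?Z" for x
  proof
    assume "poly (pderiv ?q) x = 0"
    then have "poly (Q x) y = poly 0 y" if "y \<in> ?Z" for y
      using Q_other[OF \<open>x \<in> ?Z\<close> that] Q_self[OF \<open>x \<in> ?Z\<close>] by (cases "x = y") auto
    then have "Q x = 0"
      by (rule poly_eqI_degree) (use card deg_Q[OF that] in auto)
    then show False using Q[OF that] radau_poly_neq_0 by simp
  qed
  define w where "w x = ?I (Q x) / poly (pderiv ?q) x" for x
  \<comment> \<open>Gauss's division argument: the quotient by \<open>?q\<close> has degree below
    \<open>N\<close>, so orthogonality removes its contribution, and the remainder equals its own
    interpolant at the nodes.\<close>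
  have exact: "?I f = (\<Sum>x\<in>?Z. w x * poly f x)" if "Polynomial.degree f \<le> 2 * N" for f
  proof -
    define g r where "g = f div ?q" and "r = f mod ?q"
    have f: "f = g * ?q + r" by (simp add: g_def r_def)
    have deg_q: "Polynomial.degree ?q = Suc N"
      using degree_radau_poly[of N] card card_poly_roots_bound[OF radau_poly_neq_0[of N]]
      by (simp add: radau_nodes_def)
    have deg_r: "Polynomial.degree r \<le> N"
      using degree_mod_less'[of ?q f] radau_poly_neq_0[of N] deg_q
      by (cases "r = 0") (auto simp: r_def)
    have "poly.coeff g j = 0" if "N \<le> j" for j
    proof (cases "g = 0")
      case False
      have "Polynomial.degree (g * ?q) = Polynomial.degree g + Suc N"
        using False radau_poly_neq_0[of N] deg_q by (simp add: degree_mult_eq)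
      moreover have "g * ?q = f - r" by (simp add: f)
      then have "Polynomial.degree (g * ?q) \<le> 2 * N"
        using degree_diff_le[OF \<open>Polynomial.degree f \<le> 2 * N\<close>, of r] deg_r by simp
      ultimately show ?thesis using that by (intro coeff_eq_0) simp
    qed simp
    then have I_f: "?I f = ?I r"
      by (subst f) (simp add: integral_poly_lincomb radau_poly_orthogonal del: poly_add poly_mult)
    have r_f: "poly r x = poly f x" if "x \<in> ?Z" for x
      by (subst f) (simp add: root[OF that])
    have "r = (\<Sum>x\<in>?Z. Polynomial.smult (poly f x / poly (pderiv ?q) x) (Q x))" (is "_ = ?s")
    proof (rule poly_eqI_degree)
      show "Polynomial.degree r < card ?Z" using deg_r card by simp
      have "Polynomial.degree ?s \<le> N"
        by (intro degree_sum_le fin order.trans[OF degree_smult_le] deg_Q)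
      then show "Polynomial.degree ?s < card ?Z" using card by simp
      fix y assume y: "y \<in> ?Z"
      have "poly ?s y = (\<Sum>x\<in>?Z. if x = y then poly f y else 0)"
        unfolding poly_sum
        by (rule sum.cong[OF refl]) (auto simp: Q_other[OF _ y] Q_self y simple)
      then show "poly r y = poly ?s y" using fin y by (simp add: r_f)
    qed
    then have "?I r = (\<Sum>x\<in>?Z. poly f x / poly (pderiv ?q) x * ?I (Q x))"
      by (simp only: integral_poly_sum[OF fin] integral_poly_lincomb)
    then show ?thesis unfolding I_f w_def by (simp add: mult.commute)
  qed
  define K where "K = ?I (Q (- 1) * ?L)"
  have deg_QL: "Polynomial.degree (Q x * ?L) \<le> 2 * N" if "x \<in> ?Z" for x
    using degree_mult_le[of "Q x" ?L] deg_Q[OF that] degree_legendre[of N] by linarith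
  have K: "w x * poly (pderiv ?q) x * poly ?L x = K" if x: "x \<in> ?Z" for x
  proof -
    have coeff_Q: "poly.coeff (Q y) N = poly.coeff ?q (Suc N)" if "y \<in> ?Z" for y
      using deg_Q[OF that] by (subst Q[OF that]) (simp add: coeff_eq_0)
    have "poly.coeff (Q x - Q (- 1)) j = 0" if "N \<le> j" for j
      using that coeff_Q[OF x] coeff_Q[OF minus_1_radau_node] deg_Q[OF x] deg_Q[OF minus_1_radau_node]
      by (cases "j = N") (auto simp: coeff_eq_0)
    then have "?I (Q x * ?L - Q (- 1) * ?L) = 0"
      unfolding left_diff_distrib[symmetric] by (rule legendre_orthogonal)
    then have "?I (Q x * ?L) = K"
      unfolding K_def integral_poly_lincomb by simp
    \<comment> \<open>The rule is exact for this product, and only the node \<open>x\<close>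
      contributes.\<close>
    moreover have "?I (Q x * ?L) = (\<Sum>y\<in>?Z. if y = x then w x * poly (pderiv ?q) x * poly ?L x else 0)"
      unfolding exact[OF deg_QL[OF x]]
      by (rule sum.cong[OF refl]) (auto simp: Q_other[OF x] Q_self[OF x])
    ultimately show ?thesis using fin x by simp
  qed
  \<comment> \<open>The boundary value of \<open>?q * ?L\<close> is 2 at 1 and 0 at the node -1, and
    orthogonality removes the term with \<open>pderiv ?L\<close>. The rule applied to
    \<open>pderiv ?q * ?L\<close> gives \<open>K\<close> at each of the \<open>N + 1\<close>
    nodes.\<close>
  have "real (Suc N) * K = 2"
  proof -
    have "?I (pderiv (?q * ?L)) = 2"
      using has_integral_pderiv[of "- 1" 1 "?q * ?L"] root[OF minus_1_radau_node]
      by (intro integral_unique) (simp add: radau_poly_def poly_legendre_1)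
    moreover have "?I (pderiv ?L * ?q) = 0"
      using degree_legendre[of N]
      by (intro radau_poly_orthogonal) (simp add: coeff_pderiv coeff_eq_0)
    ultimately have "?I (pderiv ?q * ?L) = 2"
      by (simp add: pderiv_mult integral_poly_lincomb mult.commute del: poly_mult poly_add)
    moreover have "Polynomial.degree (pderiv ?q * ?L) \<le> 2 * N"
      using degree_mult_le[of "pderiv ?q" ?L] degree_legendre[of N] degree_radau_poly[of N]
      by (simp add: degree_pderiv)
    ultimately have "(\<Sum>x\<in>?Z. w x * (poly (pderiv ?q) x * poly ?L x)) = 2"
      using exact[of "pderiv ?q * ?L"] by simp
    then show ?thesis using K card by (simp add: mult.assoc)
  qed
  have "w x = (1 - x) / (real (Suc N) * poly ?L x)\<^sup>2" if x: "x \<in> ?Z" for x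
  proof -
    have "x < 1" using x radau_nodes_subset[of N] by auto
    have "poly (legendre (Suc N)) x = - poly ?L x"
      using root[OF x] by (simp add: radau_poly_def)
    then have *: "(1 - x) * poly (pderiv ?q) x = 2 * real (Suc N) * poly ?L x"
      using linear_mult_pderiv_radau_poly[of x N] by simp
    with simple[OF x] \<open>x < 1\<close> have L: "poly ?L x \<noteq> 0" by auto
    \<comment> \<open>This grouping serves twice: it exposes \<open>K\<close>, and substituting
      \<open>*\<close> for the bracket completes the square in the denominator of the
      weight.\<close>
    have "w x * ((1 - x) * poly (pderiv ?q) x) * (real (Suc N) * poly ?L x)
        = (1 - x) * (real (Suc N) * (w x * poly (pderiv ?q) x * poly ?L x))"
      by (simp only: mult_ac)
    also have "\<dots> = (1 - x) * 2"
      by (simp only: K[OF x] \<open>real (Suc N) * K = 2\<close>)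
    finally have "w x * (real (Suc N) * poly ?L x)\<^sup>2 = 1 - x"
      unfolding * by (simp add: power2_eq_square mult_ac del: of_nat_Suc)
    then show ?thesis using L by (simp add: eq_divide_eq del: of_nat_Suc)
  qed
  then show ?thesis using exact[OF assms] by simp
qed

section \<open>Increments of polynomials bounded by the quadrature\<close>

text \<open>Cauchy-Schwarz against the constant 1, obtained by expanding the nonnegative integral of
  \<open>(p' - m)^2\<close> with \<open>m\<close> the mean slope.\<close>

lemma poly_increment_le_integral:
  fixes p :: "real poly"
  assumes "a \<le> b"
  shows "(poly p b - poly p a)\<^sup>2 \<le> (b - a) * integral {a..b} (poly ((pderiv p)\<^sup>2))"
proof (cases "a = b")
  case False
  define m where "m = (poly p b - poly p a) / (b - a)"
  have D: "integral {a..b} (poly (pderiv p)) = poly p b - poly p a"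
    by (rule integral_unique[OF has_integral_pderiv[OF assms]])
  have "poly [:m\<^sup>2:] = (\<lambda>_. m\<^sup>2)" by auto
  then have C: "integral {a..b} (poly [:m\<^sup>2:]) = m\<^sup>2 * (b - a)"
    using assms by simp
  have "(pderiv p - [:m:])\<^sup>2 = (pderiv p)\<^sup>2 - Polynomial.smult (2 * m) (pderiv p) + [:m\<^sup>2:]"
    unfolding poly_eq_poly_eq_iff[symmetric] fun_eq_iff
    by (simp add: power2_eq_square algebra_simps)
  then have "integral {a..b} (poly ((pderiv p - [:m:])\<^sup>2))
      = integral {a..b} (poly ((pderiv p)\<^sup>2)) - 2 * m * (poly p b - poly p a) + m\<^sup>2 * (b - a)"
    by (simp only: integral_poly_lincomb C D)
  moreover have "0 \<le> integral {a..b} (poly ((pderiv p - [:m:])\<^sup>2))"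
    by (rule integral_nonneg[OF integrable_poly]) simp
  moreover have "m\<^sup>2 * (b - a) = m * (poly p b - poly p a)"
    using False by (simp add: m_def power2_eq_square)
  ultimately have "m * (poly p b - poly p a) \<le> integral {a..b} (poly ((pderiv p)\<^sup>2))"
    by linarith
  then have "(b - a) * (m * (poly p b - poly p a)) \<le> (b - a) * integral {a..b} (poly ((pderiv p)\<^sup>2))"
    using assms by (intro mult_left_mono) auto
  then show ?thesis
    using False by (simp add: m_def power2_eq_square)
qed simp

text \<open>The leading 2 is the length of [-1, 1]. Since \<open>(p')^2\<close> is nonnegative, its
  integral may be enlarged to the whole interval, where the quadrature is exact because the degree
  is at most \<open>2 * N\<close>.\<close>

lemma poly_increment_le_radau:
  fixes p :: "real poly"
  assumes "Polynomial.degree p \<le> N" "s \<in> {- 1..1}" "t \<in> {- 1..1}"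
  shows "(poly p s - poly p t)\<^sup>2 \<le> 2 * (\<Sum>x\<in>radau_nodes N.
    (1 - x) / (real (Suc N) * poly (legendre N) x)\<^sup>2 * (poly (pderiv p) x)\<^sup>2)"
proof -
  let ?I = "\<lambda>a b. integral {a..b} (poly ((pderiv p)\<^sup>2))"
  have nonneg: "0 \<le> ?I a b" for a b
    by (rule integral_nonneg[OF integrable_poly]) simp
  have ordered: "(poly p b - poly p a)\<^sup>2 \<le> 2 * ?I (- 1) 1" if "- 1 \<le> a" "a \<le> b" "b \<le> 1" for a b
  proof -
    have "(poly p b - poly p a)\<^sup>2 \<le> (b - a) * ?I a b"
      by (rule poly_increment_le_integral[OF that(2)])
    also have "\<dots> \<le> 2 * ?I (- 1) 1"
      using that nonneg by (intro mult_mono integral_subset_le integrable_poly) auto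
    finally show ?thesis .
  qed
  have "(poly p s - poly p t)\<^sup>2 \<le> 2 * ?I (- 1) 1"
    using ordered[of s t] ordered[of t s] assms(2,3) by (cases "s \<le> t") (auto simp: power2_commute)
  also have "Polynomial.degree ((pderiv p)\<^sup>2) \<le> 2 * N"
    using degree_power_le[of "pderiv p" 2] assms(1) by (simp add: degree_pderiv)
  then have "?I (- 1) 1 = (\<Sum>x\<in>radau_nodes N.
      (1 - x) / (real (Suc N) * poly (legendre N) x)\<^sup>2 * (poly (pderiv p) x)\<^sup>2)"
    by (simp add: radau_quadrature)
  finally show ?thesis .
qed

section \<open>Transfer from [-1, 1] to the sampling interval\<close>

lemma poly_shifted_legendre:
  "poly (shifted_legendre \<tau> k) t = poly (legendre k) (2 / \<tau> * t - 1)"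
  by (simp add: shifted_legendre_def poly_pcompose mult.commute)

text \<open>The shifted node polynomial is the reference one composed with an increasing affine map.
  So it has exactly \<open>N + 1\<close> zeros, \<open>qnode\<close> enumerates them up to index
  \<open>N\<close>, and the smallest corresponds to -1.\<close>

lemma
  assumes "0 < \<tau>"
  shows bij_betw_qnode: "bij_betw (\<lambda>j. 2 / \<tau> * qnode \<tau> N j - 1) {..N} (radau_nodes N)"
    and qnode_0: "qnode \<tau> N 0 = 0"
proof -
  define T where "T = {t. poly (shifted_legendre \<tau> N + shifted_legendre \<tau> (N + 1)) t = 0}"
  have T: "t \<in> T \<longleftrightarrow> 2 / \<tau> * t - 1 \<in> radau_nodes N" for t
    by (simp add: T_def radau_nodes_def radau_poly_def poly_shifted_legendre)
  have bij: "bij_betw (\<lambda>t. 2 / \<tau> * t - 1) T (radau_nodes N)"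
  proof (rule bij_betwI[where g = "\<lambda>x. (x + 1) * \<tau> / 2"])
    have "2 / \<tau> * ((x + 1) * \<tau> / 2) - 1 = x" for x
      using assms by (simp add: field_simps)
    then show "(\<lambda>x. (x + 1) * \<tau> / 2) \<in> radau_nodes N \<rightarrow> T"
      by (simp add: T)
  qed (use assms in \<open>auto simp: T field_simps\<close>)
  have finT: "finite T"
    using bij_betw_finite[OF bij] finite_radau_nodes by blast
  have cardT: "card T = Suc N"
    using bij_betw_same_card[OF bij] card_radau_nodes by simp
  have qnode_T: "qnode \<tau> N = (!) (sorted_list_of_set T)"
    by (simp add: fun_eq_iff qnode_def T_def)
  have "bij_betw ((!) (sorted_list_of_set T)) {..<length (sorted_list_of_set T)} (set (sorted_list_of_set T))"
    by (rule bij_betw_nth) simp_all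
  then have "bij_betw (qnode \<tau> N) {..N} T"
    using finT cardT by (simp add: qnode_T lessThan_Suc_atMost)
  from bij_betw_trans[OF this bij]
  show "bij_betw (\<lambda>j. 2 / \<tau> * qnode \<tau> N j - 1) {..N} (radau_nodes N)"
    by (simp add: o_def)
  have "0 \<in> T" using minus_1_radau_node by (simp add: T)
  moreover have "0 \<le> t" if "t \<in> T" for t
  proof -
    have "- 1 \<le> 2 / \<tau> * t - 1"
      using that radau_nodes_subset[of N] by (auto simp: T)
    then show ?thesis using assms by (simp add: zero_le_divide_iff)
  qed
  ultimately have "Min T = 0"
    using finT by (intro Min_eqI) auto
  moreover have "T \<noteq> {}" using \<open>0 \<in> T\<close> by auto
  ultimately show "qnode \<tau> N 0 = 0"
    using finT sorted_list_of_set_nonempty[of T] by (simp add: qnode_T)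
qed

lemma inj_on_qnode:
  assumes "0 < \<tau>"
  shows "inj_on (qnode \<tau> N) {..N}"
  using bij_betw_imp_inj_on[OF bij_betw_qnode[OF assms, of N]] by (auto simp: inj_on_def)

lemma qnode_less:
  assumes "0 < \<tau>" "j \<le> N"
  shows "qnode \<tau> N j < \<tau>"
proof -
  have "2 / \<tau> * qnode \<tau> N j - 1 \<in> {- 1..<1}"
    using bij_betwE[OF bij_betw_qnode[OF assms(1), of N]] radau_nodes_subset[of N] assms(2) by blast
  then show ?thesis
    using assms(1) by (simp add: field_simps)
qed

text \<open>Under the affine map the squared derivative contributes \<open>(\<tau> / 2)^2\<close>
  and \<open>1 - x\<close> becomes \<open>2 * (\<tau> - t) / \<tau>\<close>; with the leading 2 this
  leaves one factor \<open>\<tau>\<close>.\<close>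

lemma poly_increment_le_qnodes:
  fixes p :: "real poly"
  assumes "0 < \<tau>" "Polynomial.degree p \<le> N" "s \<in> {0..\<tau>}" "t \<in> {0..\<tau>}"
  shows "(poly p s - poly p t)\<^sup>2 \<le> \<tau> / (real (Suc N))\<^sup>2 * (\<tau> * (poly (pderiv p) 0)\<^sup>2
    + (\<Sum>j=1..N. (\<tau> - qnode \<tau> N j) / (poly (shifted_legendre \<tau> N) (qnode \<tau> N j))\<^sup>2
        * (poly (pderiv p) (qnode \<tau> N j))\<^sup>2))"
proof -
  let ?a = "\<lambda>t. 2 / \<tau> * t - 1" and ?q = "qnode \<tau> N" and ?L = "poly (shifted_legendre \<tau> N)"
  let ?f = "\<lambda>t. (\<tau> - t) / (?L t)\<^sup>2 * (poly (pderiv p) t)\<^sup>2"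
  define P where "P = pcompose p [:\<tau> / 2, \<tau> / 2:]"
  have P: "poly P (?a t) = poly p t" for t
    using assms(1) by (simp add: P_def poly_pcompose field_simps)
  have P': "poly (pderiv P) (?a t) = \<tau> / 2 * poly (pderiv p) t" for t
    using assms(1) by (simp add: P_def poly_pcompose pderiv_pcompose pderiv_pCons field_simps)
  have "(poly p s - poly p t)\<^sup>2 = (poly P (?a s) - poly P (?a t))\<^sup>2"
    by (simp only: P)
  also have "\<dots> \<le> 2 * (\<Sum>x\<in>radau_nodes N.
      (1 - x) / (real (Suc N) * poly (legendre N) x)\<^sup>2 * (poly (pderiv P) x)\<^sup>2)"
    using assms by (intro poly_increment_le_radau)
      (auto simp: P_def degree_pcompose field_simps)
  also have "\<dots> = (\<Sum>j\<le>N. 2 * ((1 - ?a (?q j)) / (real (Suc N) * poly (legendre N) (?a (?q j)))\<^sup>2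
      * (poly (pderiv P) (?a (?q j)))\<^sup>2))"
    unfolding sum_distrib_left by (subst sum.reindex_bij_betw[OF bij_betw_qnode[OF assms(1)], symmetric]) simp
  also have "\<dots> = (\<Sum>j\<le>N. \<tau> / (real (Suc N))\<^sup>2 * ?f (?q j))"
  proof (rule sum.cong[OF refl])
    fix j
    \<comment> \<open>If \<open>D\<close> or \<open>L\<close> is 0, both sides are 0 because
      division by zero yields 0.\<close>
    have *: "2 * (2 * e / \<tau> / (D * L)\<^sup>2 * (\<tau> / 2 * v)\<^sup>2) = \<tau> / D\<^sup>2 * (e / L\<^sup>2 * v\<^sup>2)"
      for e D L v :: real
      using assms(1) by (cases "D = 0 \<or> L = 0") (auto simp: field_simps power2_eq_square)
    have "1 - ?a (?q j) = 2 * (\<tau> - ?q j) / \<tau>"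
      using assms(1) by (simp add: field_simps)
    then show "2 * ((1 - ?a (?q j)) / (real (Suc N) * poly (legendre N) (?a (?q j)))\<^sup>2
        * (poly (pderiv P) (?a (?q j)))\<^sup>2) = \<tau> / (real (Suc N))\<^sup>2 * ?f (?q j)"
      unfolding P' poly_shifted_legendre by (simp only: *)
  qed
  also have "\<dots> = \<tau> / (real (Suc N))\<^sup>2 * (\<Sum>j\<le>N. ?f (?q j))"
    by (simp add: sum_distrib_left)
  also have "(\<Sum>j\<le>N. ?f (?q j)) = ?f (?q 0) + (\<Sum>j=1..N. ?f (?q j))"
    by (simp add: sum.atMost_shift sum.atLeast1_atMost_eq)
  \<comment> \<open>At the left end the Legendre value is \<open>(- 1)^N\<close>, whose square is
    1.\<close>
  also have "?f (?q 0) = \<tau> * (poly (pderiv p) 0)\<^sup>2"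
    using assms(1) by (simp add: qnode_0 poly_shifted_legendre poly_legendre_minus_1 flip: power_mult)
  finally show ?thesis .
qed

lemma degree_lagrange: "i \<le> N \<Longrightarrow> Polynomial.degree (lagrange \<tau> N i) \<le> N"
proof -
  assume i: "i \<le> N"
  have "Polynomial.degree (lagrange \<tau> N i) \<le> (\<Sum>j\<in>{0..N} - {i}. 1)"
    unfolding lagrange_def
    by (intro order.trans[OF degree_prod_sum_le] sum_mono order.trans[OF degree_smult_le]) simp_all
  then show ?thesis using i by simp
qed

lemma poly_lagrange_qnode:
  assumes "0 < \<tau>" "i \<le> N" "j \<le> N"
  shows "poly (lagrange \<tau> N i) (qnode \<tau> N j) = (if i = j then 1 else 0)"
proof -
  have neq: "qnode \<tau> N i \<noteq> qnode \<tau> N k" if "k \<le> N" "k \<noteq> i" for k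
    using inj_onD[OF inj_on_qnode[OF assms(1), of N]] that assms(2) by auto
  have eq: "poly (lagrange \<tau> N i) (qnode \<tau> N j)
      = (\<Prod>k\<in>{0..N} - {i}. (qnode \<tau> N j - qnode \<tau> N k) / (qnode \<tau> N i - qnode \<tau> N k))"
    unfolding lagrange_def poly_prod by (rule prod.cong) (auto simp: diff_divide_distrib)
  show ?thesis
  proof (cases "i = j")
    case True
    then show ?thesis unfolding eq using neq by (auto intro!: prod.neutral)
  next
    case False
    then show ?thesis unfolding eq using assms(3) by (auto intro!: bexI[of _ j])
  qed
qed

section \<open>Linear control systems\<close>

text \<open>Gronwall's argument: the energy \<open>E\<close> satisfies
  \<open>E' \<le> M * E\<close>, so \<open>E * exp (- M * s)\<close> cannot grow from its initial
  value 0.\<close>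

lemma linear_ode_zero:
  fixes z :: "nat \<Rightarrow> real \<Rightarrow> real" and a :: "nat \<Rightarrow> nat \<Rightarrow> real"
  assumes deriv: "\<And>k s. k < n \<Longrightarrow> s \<in> {0..T} \<Longrightarrow>
      (z k has_real_derivative (\<Sum>j<n. a k j * z j s)) (at s within {0..T})"
    and init: "\<And>k. k < n \<Longrightarrow> z k 0 = 0"
    and "0 \<le> T" "k < n"
  shows "z k T = 0"
proof -
  define E where "E s = (\<Sum>k<n. (z k s)\<^sup>2)" for s
  define E' where "E' s = (\<Sum>k<n. 2 * (z k s * (\<Sum>j<n. a k j * z j s)))" for s
  define M where "M = 2 * (\<Sum>k<n. \<Sum>j<n. \<bar>a k j\<bar>)"
  define F where "F s = E s * exp (- M * s)" for s
  have z_le: "(z k s)\<^sup>2 \<le> E s" if "k < n" for k s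
    unfolding E_def using that by (intro member_le_sum) auto
  have E'_le: "E' s \<le> M * E s" for s
  proof -
    \<comment> \<open>\<open>M\<close> collects one bound
      \<open>2 * |z_k z_j| \<le> z_k^2 + z_j^2 \<le> 2 * E\<close> for each matrix entry.\<close>
    have "2 * (z k s * (a k j * z j s)) \<le> 2 * \<bar>a k j\<bar> * E s" if "k < n" "j < n" for k j
    proof -
      have "2 * \<bar>z k s * z j s\<bar> \<le> (z k s)\<^sup>2 + (z j s)\<^sup>2"
        using sum_squares_bound[of "\<bar>z k s\<bar>" "\<bar>z j s\<bar>"] by (simp add: abs_mult)
      then have "\<bar>z k s * z j s\<bar> \<le> E s"
        using z_le[OF that(1), of s] z_le[OF that(2), of s] by linarith
      then have "\<bar>a k j\<bar> * \<bar>z k s * z j s\<bar> \<le> \<bar>a k j\<bar> * E s"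
        by (intro mult_left_mono) auto
      moreover have "z k s * (a k j * z j s) \<le> \<bar>a k j\<bar> * \<bar>z k s * z j s\<bar>"
        using abs_ge_self[of "a k j * (z k s * z j s)"] by (simp only: abs_mult mult_ac)
      ultimately show ?thesis by linarith
    qed
    then show ?thesis
      unfolding E'_def M_def sum_distrib_left sum_distrib_right
      by (intro sum_mono) (auto simp: mult.assoc)
  qed
  have E_deriv: "(E has_real_derivative E' s) (at s within {0..T})" if "s \<in> {0..T}" for s
    unfolding E_def[abs_def] E'_def
  proof (rule DERIV_sum)
    fix k assume "k \<in> {..<n}"
    then have "(z k has_real_derivative (\<Sum>j<n. a k j * z j s)) (at s within {0..T})"
      using deriv that by simp
    from DERIV_mult[OF this this]
    show "((\<lambda>s. (z k s)\<^sup>2) has_real_derivative 2 * (z k s * (\<Sum>j<n. a k j * z j s))) (at s within {0..T})"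
      by (simp add: power2_eq_square mult.commute)
  qed
  have F_deriv: "(F has_real_derivative (E' s - M * E s) * exp (- M * s)) (at s within {0..T})"
    if "s \<in> {0..T}" for s
  proof -
    have "((\<lambda>s. exp (- M * s)) has_real_derivative exp (- M * s) * - M) (at s within {0..T})"
      by (auto intro!: derivative_eq_intros)
    from DERIV_mult[OF E_deriv[OF that] this] show ?thesis
      unfolding F_def[abs_def] by (simp add: algebra_simps)
  qed
  have "F T \<le> F 0"
  proof (rule DERIV_nonpos_imp_decreasing_open[OF \<open>0 \<le> T\<close>])
    fix s assume s: "0 < s" "s < T"
    then have "(F has_real_derivative (E' s - M * E s) * exp (- M * s)) (at s)"
      using F_deriv[of s] at_within_Icc_at[of 0 s T] by simp
    moreover have "(E' s - M * E s) * exp (- M * s) \<le> 0"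
      using E'_le[of s] by (simp add: mult_le_0_iff)
    ultimately show "\<exists>y. (F has_real_derivative y) (at s) \<and> y \<le> 0" by blast
  next
    show "continuous_on {0..T} F" by (rule DERIV_continuous_on[OF F_deriv])
  qed
  also have "F 0 = 0" by (simp add: F_def E_def init)
  finally have "E T \<le> 0" by (simp add: F_def mult_le_0_iff)
  with z_le[OF \<open>k < n\<close>, of T] have "(z k T)\<^sup>2 \<le> 0" by linarith
  then show ?thesis by simp
qed

lemma mult_mat_vec_sum:
  assumes "A \<in> carrier_mat r c" "v \<in> carrier_vec c" "k < r"
  shows "(A *\<^sub>v v) $ k = (\<Sum>j<c. A $$ (k, j) * v $ j)"
  using assms by (simp add: scalar_prod_def atLeast0LessThan)

section \<open>Uniqueness and concatenation of trajectories\<close>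

lemma ct_solutionD:
  assumes "ct_solution A B x0 u T x" "A \<in> carrier_mat n n'"
  shows "x 0 = x0"
    and "s \<in> {0..T} \<Longrightarrow> x s \<in> carrier_vec n"
    and "s \<in> {0..T} \<Longrightarrow> k < n \<Longrightarrow>
      ((\<lambda>r. x r $ k) has_real_derivative (A *\<^sub>v x s + B *\<^sub>v u s) $ k) (at s within {0..T})"
proof -
  have d: "dim_row A = n" using assms(2) by simp
  note x = assms(1)[unfolded ct_solution_def d]
  show "x 0 = x0" using x by (rule conjunct1)
  show "x s \<in> carrier_vec n" if "s \<in> {0..T}"
    using conjunct1[OF bspec[OF conjunct2[OF x] that]] .
  show "((\<lambda>r. x r $ k) has_real_derivative (A *\<^sub>v x s + B *\<^sub>v u s) $ k) (at s within {0..T})"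
    if "s \<in> {0..T}" "k < n"
    by (rule conjunct2[OF bspec[OF conjunct2[OF x] that(1)], rule_format, OF that(2)])
qed

lemma ct_solution_unique:
  assumes A: "A \<in> carrier_mat n n" and B: "B \<in> carrier_mat n m"
    and x: "ct_solution A B x0 u T x" and y: "ct_solution A B x0 u T y" and "0 \<le> T"
  shows "x T = y T"
proof (rule eq_vecI)
  have carrier: "x s \<in> carrier_vec n" "y s \<in> carrier_vec n" if "s \<in> {0..T}" for s
    using ct_solutionD(2)[OF x A that] ct_solutionD(2)[OF y A that] by blast+
  have T: "T \<in> {0..T}" using \<open>0 \<le> T\<close> by simp
  show "dim_vec (x T) = dim_vec (y T)"
    by (simp only: carrier_vecD[OF carrier(1)[OF T]] carrier_vecD[OF carrier(2)[OF T]])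
  fix k assume "k < dim_vec (y T)"
  then have k: "k < n" by (simp only: carrier_vecD[OF carrier(2)[OF T]])
  have "x T $ k - y T $ k = 0"
  proof (rule linear_ode_zero[where z = "\<lambda>k s. x s $ k - y s $ k" and a = "\<lambda>k j. A $$ (k, j)"
        and n = n, OF _ _ \<open>0 \<le> T\<close> k])
    fix k s assume k: "k < n" and s: "s \<in> {0..T}"
    have "((\<lambda>s. x s $ k - y s $ k) has_real_derivative
        (A *\<^sub>v x s + B *\<^sub>v u s) $ k - (A *\<^sub>v y s + B *\<^sub>v u s) $ k) (at s within {0..T})"
      by (rule DERIV_diff[OF ct_solutionD(3)[OF x A s k] ct_solutionD(3)[OF y A s k]])
    also have "(A *\<^sub>v x s + B *\<^sub>v u s) $ k - (A *\<^sub>v y s + B *\<^sub>v u s) $ k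
        = (A *\<^sub>v x s) $ k - (A *\<^sub>v y s) $ k"
      using k A B by (simp del: index_mult_mat_vec)
    also have "\<dots> = (\<Sum>j<n. A $$ (k, j) * (x s $ j - y s $ j))"
      unfolding mult_mat_vec_sum[OF A carrier(1)[OF s] k] mult_mat_vec_sum[OF A carrier(2)[OF s] k]
      by (simp add: sum_subtractf right_diff_distrib)
    finally show "((\<lambda>s. x s $ k - y s $ k) has_real_derivative
      (\<Sum>j<n. A $$ (k, j) * (x s $ j - y s $ j))) (at s within {0..T})" .
  qed (simp add: ct_solutionD(1)[OF x A] ct_solutionD(1)[OF y A])
  then show "x T $ k = y T $ k" by simp
qed

text \<open>Uniqueness makes the definite description in \<open>ct_traj\<close> denote. Its horizon
  is the evaluation time, so a solution up to \<open>T\<close> suffices.\<close>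

lemma ct_traj_eq:
  assumes "A \<in> carrier_mat n n" "B \<in> carrier_mat n m" "ct_solution A B x0 u T x" "0 \<le> T"
  shows "ct_traj A B x0 u T = x T"
  unfolding ct_traj_def
proof (rule the_equality)
  show "\<exists>y. ct_solution A B x0 u T y \<and> x T = y T" using assms(3) by blast
  fix v assume "\<exists>y. ct_solution A B x0 u T y \<and> v = y T"
  then obtain y where "ct_solution A B x0 u T y" "v = y T" by blast
  then show "v = x T" using ct_solution_unique[OF assms(1,2) _ assms(3,4)] by simp
qed

text \<open>At the junction both one-sided derivatives are the same right-hand side because
  \<open>z 0 = x a\<close>, so the glued curve is differentiable there too.\<close>

lemma ct_solution_append:
  assumes A: "A \<in> carrier_mat n n'"
    and x: "ct_solution A B x0 u a x" and z: "ct_solution A B (x a) (\<lambda>s. u (a + s)) b z"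
    and ab: "0 \<le> a" "0 \<le> b"
  shows "ct_solution A B x0 u (a + b) (\<lambda>s. if s \<in> {0..a} then x s else z (s - a))"
proof -
  let ?y = "\<lambda>s. if s \<in> {0..a} then x s else z (s - a)"
  have d: "dim_row A = n" using A by simp
  have z0: "z 0 = x a" by (rule ct_solutionD(1)[OF z A])
  have carrier: "?y s \<in> carrier_vec n" if "s \<in> {0..a + b}" for s
    using ct_solutionD(2)[OF x A, of s] ct_solutionD(2)[OF z A, of "s - a"] that
    by (cases "s \<le> a") simp_all
  have deriv: "((\<lambda>r. ?y r $ k) has_real_derivative (A *\<^sub>v ?y s + B *\<^sub>v u s) $ k) (at s within {0..a + b})"
    if s: "s \<in> {0..a + b}" and k: "k < n" for s k
  proof -
    let ?f' = "\<lambda>s. (A *\<^sub>v x s + B *\<^sub>v u s) $ k"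
    let ?g' = "\<lambda>s. (A *\<^sub>v z (s - a) + B *\<^sub>v u s) $ k"
    have f: "((\<lambda>r. x r $ k) has_vector_derivative ?f' s) (at s within {0..a})" if "s \<in> {0..a}" for s
      using ct_solutionD(3)[OF x A that k] by (simp only: has_real_derivative_iff_has_vector_derivative)
    have g: "((\<lambda>r. z (r - a) $ k) has_vector_derivative ?g' s) (at s within {a..a + b})"
      if "s \<in> {a..a + b}" for s
    proof -
      have "(\<lambda>r. r - a) ` {a..a + b} = {0..b}" by simp
      then have "((\<lambda>r. z r $ k) has_real_derivative ?g' s) (at (s - a) within (\<lambda>r. r - a) ` {a..a + b})"
        using ct_solutionD(3)[OF z A _ k, of "s - a"] that by (simp del: index_add_vec)
      moreover have "((\<lambda>r. r - a) has_real_derivative 1) (at s within {a..a + b})"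
        by (auto intro!: derivative_eq_intros)
      ultimately have "((\<lambda>r. z r $ k) \<circ> (\<lambda>r. r - a) has_real_derivative ?g' s * 1) (at s within {a..a + b})"
        by (rule DERIV_image_chain)
      then show ?thesis by (simp only: o_def has_real_derivative_iff_has_vector_derivative mult_1_right)
    qed
    have inter: "{0..a} \<inter> {a..a + b} = {a}" using ab by auto
    have "((\<lambda>r. if r \<in> {0..a} then x r $ k else z (r - a) $ k) has_vector_derivative
        (if s \<in> {0..a} then ?f' s else ?g' s)) (at s within {0..a + b})"
    proof (rule has_vector_derivative_If_within_closures[where T = "{a..a + b}"])
      show "{0..a + b} = {0..a} \<union> {a..a + b}" using ab by auto
      then show "s \<in> {0..a} \<union> {a..a + b}" using s by simp
      \<comment> \<open>Both intervals are closed and contain \<open>a\<close>, so adding the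
        intersection of the closures changes neither.\<close>
      have cl: "closure {0..a} \<inter> closure {a..a + b} = {a}" "a \<in> {0..a}" "a \<in> {a..a + b}"
        using ab inter by simp_all
      then have un: "{0..a} \<union> (closure {0..a} \<inter> closure {a..a + b}) = {0..a}"
        "{a..a + b} \<union> (closure {0..a} \<inter> closure {a..a + b}) = {a..a + b}"
        unfolding cl(1) by (simp_all only: Un_insert_right Un_empty_right insert_absorb[OF cl(2)] insert_absorb[OF cl(3)])
      show "((\<lambda>r. x r $ k) has_vector_derivative ?f' s)
          (at s within {0..a} \<union> (closure {0..a} \<inter> closure {a..a + b}))"
        if "s \<in> {0..a} \<union> (closure {0..a} \<inter> closure {a..a + b})"
        using that unfolding un by (rule f)
      show "((\<lambda>r. z (r - a) $ k) has_vector_derivative ?g' s)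
          (at s within {a..a + b} \<union> (closure {0..a} \<inter> closure {a..a + b}))"
        if "s \<in> {a..a + b} \<union> (closure {0..a} \<inter> closure {a..a + b})"
        using that unfolding un by (rule g)
      assume "s \<in> closure {0..a}" "s \<in> closure {a..a + b}"
      then have "s = a" using cl(1) by blast
      then show "x s $ k = z (s - a) $ k" "?f' s = ?g' s" by (simp_all only: diff_self z0)
    qed
    moreover have "(\<lambda>r. ?y r $ k) = (\<lambda>r. if r \<in> {0..a} then x r $ k else z (r - a) $ k)"
      by (rule ext) (simp split: if_split)
    moreover have "(A *\<^sub>v ?y s + B *\<^sub>v u s) $ k = (if s \<in> {0..a} then ?f' s else ?g' s)"
      by (cases "s \<in> {0..a}") (simp_all only: if_True if_False)
    ultimately show ?thesis
      by (simp only: has_real_derivative_iff_has_vector_derivative)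
  qed
  show ?thesis
    unfolding ct_solution_def d
    using ct_solutionD(1)[OF x A] ab carrier deriv by (intro conjI ballI allI impI) simp_all
qed

section \<open>Block matrices\<close>

lemma append_cols_carrier [simp, intro]:
  "A \<in> carrier_mat r c1 \<Longrightarrow> B \<in> carrier_mat r c2 \<Longrightarrow> A @\<^sub>c B \<in> carrier_mat r (c1 + c2)"
  unfolding append_cols_def by auto

lemma append_cols_mult_vec:
  assumes "A \<in> carrier_mat r c1" "B \<in> carrier_mat r c2" "x \<in> carrier_vec c1" "y \<in> carrier_vec c2"
  shows "(A @\<^sub>c B) *\<^sub>v (x @\<^sub>v y) = A *\<^sub>v x + B *\<^sub>v y"
proof -
  have "(A @\<^sub>c B) *\<^sub>v (x @\<^sub>v y)
      = (A *\<^sub>v x + B *\<^sub>v y) @\<^sub>v (0\<^sub>m 0 c1 *\<^sub>v x + 0\<^sub>m 0 c2 *\<^sub>v y)"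
    unfolding append_cols_def using assms by (subst four_block_mat_mult_vec) auto
  then show ?thesis using assms by (auto intro!: eq_vecI)
qed

lemma kron_carrier [simp, intro]:
  "P \<in> carrier_mat p q \<Longrightarrow> Q \<in> carrier_mat a b \<Longrightarrow> kron P Q \<in> carrier_mat (p * a) (q * b)"
  unfolding kron_def by auto

lemma kron_sum_carrier [simp, intro]:
  "P \<in> carrier_mat p p \<Longrightarrow> Q \<in> carrier_mat a a \<Longrightarrow> kron_sum P Q \<in> carrier_mat (p * a) (p * a)"
  unfolding kron_sum_def by auto

lemma vec_of_cols_carrier [simp, intro]:
  "X \<in> carrier_mat b q \<Longrightarrow> vec_of_cols X \<in> carrier_vec (q * b)"
  unfolding vec_of_cols_def by auto

lemma block_index_less: "r < p \<Longrightarrow> k < a \<Longrightarrow> r * a + k < p * (a :: nat)"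
  using mult_le_mono1[of "Suc r" p a] by simp

text \<open>Entrywise form of \<open>(P \<otimes> Q) vec X = vec (Q X P^T)\<close>: index
  \<open>r * a + k\<close> is entry \<open>k\<close> of block \<open>r\<close>.\<close>

lemma kron_mult_vec_of_cols:
  assumes P: "P \<in> carrier_mat p q" and Q: "Q \<in> carrier_mat a b" and X: "X \<in> carrier_mat b q"
    and r: "r < p" and k: "k < a"
  shows "(kron P Q *\<^sub>v vec_of_cols X) $ (r * a + k)
    = (\<Sum>j<q. P $$ (r, j) * (\<Sum>c<b. Q $$ (k, c) * X $$ (c, j)))"
proof -
  have "(kron P Q *\<^sub>v vec_of_cols X) $ (r * a + k)
      = (\<Sum>i<q * b. kron P Q $$ (r * a + k, i) * vec_of_cols X $ i)"
    by (rule mult_mat_vec_sum[OF kron_carrier[OF P Q] vec_of_cols_carrier[OF X] block_index_less[OF r k]])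
  \<comment> \<open>Blocks of length \<open>b\<close> isolate the columns of
    \<open>X\<close>.\<close>
  also have "\<dots> = (\<Sum>j<q. \<Sum>i\<in>{j * b..<j * b + b}. kron P Q $$ (r * a + k, i) * vec_of_cols X $ i)"
    by (rule sum.nat_group[symmetric])
  also have "\<dots> = (\<Sum>j<q. \<Sum>c<b. P $$ (r, j) * (Q $$ (k, c) * X $$ (c, j)))"
  proof (rule sum.cong[OF refl])
    fix j assume "j \<in> {..<q}"
    then have j: "j < q" by simp
    have "(\<Sum>i\<in>{j * b..<j * b + b}. kron P Q $$ (r * a + k, i) * vec_of_cols X $ i)
        = (\<Sum>c<b. kron P Q $$ (r * a + k, j * b + c) * vec_of_cols X $ (j * b + c))"
      using sum.shift_bounds_nat_ivl[of "\<lambda>i. kron P Q $$ (r * a + k, i) * vec_of_cols X $ i" 0 "j * b" b]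
      by (simp add: add.commute atLeast0LessThan)
    also have "\<dots> = (\<Sum>c<b. P $$ (r, j) * (Q $$ (k, c) * X $$ (c, j)))"
    proof (rule sum.cong[OF refl])
      fix c assume "c \<in> {..<b}"
      then have c: "c < b" by simp
      show "kron P Q $$ (r * a + k, j * b + c) * vec_of_cols X $ (j * b + c)
          = P $$ (r, j) * (Q $$ (k, c) * X $$ (c, j))"
        using P Q X k c block_index_less[OF r k] block_index_less[OF j c]
        by (simp add: kron_def vec_of_cols_def)
    qed
    finally show "(\<Sum>i\<in>{j * b..<j * b + b}. kron P Q $$ (r * a + k, i) * vec_of_cols X $ i)
        = (\<Sum>c<b. P $$ (r, j) * (Q $$ (k, c) * X $$ (c, j)))" .
  qed
  finally show ?thesis by (simp add: sum_distrib_left)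
qed

lemma kron_one_left_mult:
  assumes "Q \<in> carrier_mat a b" "X \<in> carrier_mat b q" "r < q" "k < a"
  shows "(kron (1\<^sub>m q) Q *\<^sub>v vec_of_cols X) $ (r * a + k) = (\<Sum>c<b. Q $$ (k, c) * X $$ (c, r))"
proof -
  have "(\<Sum>j<q. 1\<^sub>m q $$ (r, j) * (\<Sum>c<b. Q $$ (k, c) * X $$ (c, j)))
      = (\<Sum>j<q. if j = r then \<Sum>c<b. Q $$ (k, c) * X $$ (c, r) else 0)"
    using assms(3) by (intro sum.cong) auto
  then show ?thesis
    using assms(3) unfolding kron_mult_vec_of_cols[OF one_carrier_mat assms(1,2,3,4)] by simp
qed

lemma kron_one_right_mult:
  assumes "P \<in> carrier_mat p q" "X \<in> carrier_mat b q" "r < p" "k < b"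
  shows "(kron P (1\<^sub>m b) *\<^sub>v vec_of_cols X) $ (r * b + k) = (\<Sum>j<q. P $$ (r, j) * X $$ (k, j))"
proof -
  have "(\<Sum>c<b. 1\<^sub>m b $$ (k, c) * X $$ (c, j)) = X $$ (k, j)" for j
  proof -
    have "(\<Sum>c<b. 1\<^sub>m b $$ (k, c) * X $$ (c, j)) = (\<Sum>c<b. if c = k then X $$ (k, j) else 0)"
      using assms(4) by (intro sum.cong) auto
    then show ?thesis using assms(4) by simp
  qed
  then show ?thesis
    using assms by (simp add: kron_mult_vec_of_cols[where q = q and b = b])
qed

lemma kron_one_right_mult_vec:
  assumes "P \<in> carrier_mat p 1" "x \<in> carrier_vec b" "r < p" "k < b"
  shows "(kron P (1\<^sub>m b) *\<^sub>v x) $ (r * b + k) = P $$ (r, 0) * x $ k"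
proof -
  let ?X = "Matrix.mat b 1 (\<lambda>(i, _). x $ i)"
  have "x = vec_of_cols ?X"
    using assms(2) by (auto simp: vec_of_cols_def intro!: eq_vecI)
  then show ?thesis
    using kron_one_right_mult[OF assms(1) _ assms(3,4), of ?X] assms(4) by simp
qed

lemma zero_mat_mult_vec [simp]: "v \<in> carrier_vec c \<Longrightarrow> 0\<^sub>m r c *\<^sub>v v = 0\<^sub>v r"
  by (auto intro!: eq_vecI simp: scalar_prod_def)

section \<open>The collocation equations, entry by entry\<close>

lemma append_rows4_mult_vec:
  assumes "A1 \<in> carrier_mat r1 c" "A2 \<in> carrier_mat r2 c" "A3 \<in> carrier_mat r3 c"
    "A4 \<in> carrier_mat r4 c" "v \<in> carrier_vec c"
  shows "(A1 @\<^sub>r A2 @\<^sub>r A3 @\<^sub>r A4) *\<^sub>v v = A1 *\<^sub>v v @\<^sub>v A2 *\<^sub>v v @\<^sub>v A3 *\<^sub>v v @\<^sub>v A4 *\<^sub>v v"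
  using mat_mult_append[OF assms(1) carrier_append_rows[OF assms(2) carrier_append_rows[OF assms(3,4)]] assms(5)]
    mat_mult_append[OF assms(2) carrier_append_rows[OF assms(3,4)] assms(5)]
    mat_mult_append[OF assms(3,4,5)]
  by (simp only:)

lemma append_rows4_mult_vec_eqD:
  assumes A: "A1 \<in> carrier_mat r1 c" "A2 \<in> carrier_mat r2 c" "A3 \<in> carrier_mat r3 c"
      "A4 \<in> carrier_mat r4 c" "v \<in> carrier_vec c"
    and B: "B1 \<in> carrier_mat r1 c'" "B2 \<in> carrier_mat r2 c'" "B3 \<in> carrier_mat r3 c'"
      "B4 \<in> carrier_mat r4 c'" "w \<in> carrier_vec c'"
    and eq: "(A1 @\<^sub>r A2 @\<^sub>r A3 @\<^sub>r A4) *\<^sub>v v = (B1 @\<^sub>r B2 @\<^sub>r B3 @\<^sub>r B4) *\<^sub>v w"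
  shows "A1 *\<^sub>v v = B1 *\<^sub>v w" "A2 *\<^sub>v v = B2 *\<^sub>v w" "A3 *\<^sub>v v = B3 *\<^sub>v w" "A4 *\<^sub>v v = B4 *\<^sub>v w"
  using eq
  unfolding append_rows4_mult_vec[OF A] append_rows4_mult_vec[OF B]
    append_vec_eq[OF mult_mat_vec_carrier[OF A(1,5)] mult_mat_vec_carrier[OF B(1,5)]]
    append_vec_eq[OF mult_mat_vec_carrier[OF A(2,5)] mult_mat_vec_carrier[OF B(2,5)]]
    append_vec_eq[OF mult_mat_vec_carrier[OF A(3,5)] mult_mat_vec_carrier[OF B(3,5)]]
  by blast+

text \<open>Moving the \<open>\<phi> 0\<close> terms to the left completes the Lagrange sums, so the
  rows speak of the interpolant through \<open>x\<close> and the columns of \<open>X\<close>: its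
  derivative at 0 and at the other nodes obeys the differential equation, and its value at
  \<open>\<tau>\<close> is the next state. Column \<open>j\<close> belongs to node
  \<open>j + 1\<close>, hence \<open>Suc j\<close>.\<close>

lemma step_equationD:
  fixes \<tau> :: real and N n m :: nat and ud :: "nat \<Rightarrow> real Matrix.vec"
  assumes Ac: "Ac \<in> carrier_mat n n" and Bc: "Bc \<in> carrier_mat n m"
    and Ad: "Ad \<in> carrier_mat n n" and Bd: "Bd \<in> carrier_mat n m"
    and X: "X \<in> carrier_mat n N" and U: "U \<in> carrier_mat m N"
    and xd: "dt_traj Ad Bd x0 ud i \<in> carrier_vec n"
    and ud: "ud i \<in> carrier_vec m" "ud (i + 1) \<in> carrier_vec m"
    and eq: "step_equation \<tau> N Ac Bc Ad Bd x0 ud i X U"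
    and k: "k < n"
  defines "x \<equiv> dt_traj Ad Bd x0 ud i" and "\<phi> \<equiv> lagrange \<tau> N"
  shows "poly (pderiv (\<phi> 0)) 0 * x $ k
      + (\<Sum>j<N. poly (pderiv (\<phi> (Suc j))) (qnode \<tau> N 0) * X $$ (k, j)) = (Ac *\<^sub>v x + Bc *\<^sub>v ud i) $ k"
    and "\<And>r. r < N \<Longrightarrow> poly (pderiv (\<phi> 0)) (qnode \<tau> N (Suc r)) * x $ k
      + (\<Sum>j<N. poly (pderiv (\<phi> (Suc j))) (qnode \<tau> N (Suc r)) * X $$ (k, j))
      = (\<Sum>c<n. Ac $$ (k, c) * X $$ (c, r)) + (\<Sum>c<m. Bc $$ (k, c) * U $$ (c, r))"
    and "poly (\<phi> 0) \<tau> * x $ k + (\<Sum>j<N. poly (\<phi> (Suc j)) \<tau> * X $$ (k, j))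
      = (Ad *\<^sub>v x + Bd *\<^sub>v ud i) $ k"
proof -
  let ?vX = "vec_of_cols X" and ?vU = "vec_of_cols U" and ?u = "ud i" and ?u' = "ud (i + 1)"
  define a b where "a = poly (pderiv (\<phi> 0)) 0" and "b = poly (\<phi> 0) \<tau>"
  define psi Psi Phi sigma where "psi = (psi_mat \<tau> N 0)\<^sup>T" and "Psi = (Psi_mat \<tau> N)\<^sup>T"
    and "Phi = (Phi_mat \<tau> N)\<^sup>T" and "sigma = (sigma_mat \<tau> N)\<^sup>T"
  note defs = psi_def Psi_def Phi_def sigma_def
  have psi: "psi \<in> carrier_mat 1 N" and Psi: "Psi \<in> carrier_mat N N"
    and Phi: "Phi \<in> carrier_mat 1 N" and sigma: "sigma \<in> carrier_mat N 1"
    by (simp_all add: defs psi_mat_def Psi_mat_def Phi_mat_def sigma_mat_def)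
  have vX: "?vX \<in> carrier_vec (N * n)" and vU: "?vU \<in> carrier_vec (N * m)" using X U by auto
  have xd: "x \<in> carrier_vec n" using xd by (simp add: x_def)
  have uu: "?u @\<^sub>v ?u' \<in> carrier_vec (m + m)" using ud by simp
  have mAc: "- Ac \<in> carrier_mat n n" using Ac by simp
  have K1: "kron psi (1\<^sub>m n) \<in> carrier_mat n (N * n)" and K3: "kron Phi (1\<^sub>m n) \<in> carrier_mat n (N * n)"
    and K4: "kron Phi (1\<^sub>m m) \<in> carrier_mat m (N * m)"
    using kron_carrier[OF psi one_carrier_mat, of n] kron_carrier[OF Phi one_carrier_mat, of n]
      kron_carrier[OF Phi one_carrier_mat, of m] by simp_all
  have K2: "kron_sum Psi (- Ac) \<in> carrier_mat (N * n) (N * n)" by (rule kron_sum_carrier[OF Psi mAc])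
  have kB: "kron (1\<^sub>m N) Bc \<in> carrier_mat (N * n) (N * m)" by (rule kron_carrier[OF one_carrier_mat Bc])
  then have KB: "- kron (1\<^sub>m N) Bc \<in> carrier_mat (N * n) (N * m)" by simp
  have ks: "kron sigma (1\<^sub>m n) \<in> carrier_mat (N * n) n"
    using kron_carrier[OF sigma one_carrier_mat, of n] by simp
  then have KS: "- kron sigma (1\<^sub>m n) \<in> carrier_mat (N * n) n" by simp
  have C1: "Ac - a \<cdot>\<^sub>m 1\<^sub>m n \<in> carrier_mat n n" and C3: "Ad - b \<cdot>\<^sub>m 1\<^sub>m n \<in> carrier_mat n n"
    and C4: "- (b \<cdot>\<^sub>m 1\<^sub>m m) \<in> carrier_mat m m" by auto
  note z = zero_carrier_mat
  have d: "dim_row Ac = n" "dim_col Bc = m" using Ac Bc by auto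
  note L = append_cols_carrier[OF K1 z[of n "N * m"]] append_cols_carrier[OF K2 KB]
    append_cols_carrier[OF K3 z[of n "N * m"]] append_cols_carrier[OF z[of m "N * n"] K4]
    append_carrier_vec[OF vX vU]
  note R = append_cols_carrier[OF C1 append_cols_carrier[OF Bc z[of n m]]]
    append_cols_carrier[OF KS append_cols_carrier[OF z[of "N * n" m] z[of "N * n" m]]]
    append_cols_carrier[OF C3 append_cols_carrier[OF Bd z[of n m]]]
    append_cols_carrier[OF z[of m n] append_cols_carrier[OF C4 one_carrier_mat[of m]]]
    append_carrier_vec[OF xd uu]
  note blocks = append_rows4_mult_vec_eqD[OF L R
      eq[unfolded step_equation_def step_lhs_mat_def step_rhs_mat_def Let_def d,
        folded \<phi>_def, folded x_def a_def b_def defs]]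
  have b1: "kron psi (1\<^sub>m n) *\<^sub>v ?vX + 0\<^sub>v n = (Ac - a \<cdot>\<^sub>m 1\<^sub>m n) *\<^sub>v x + (Bc *\<^sub>v ?u + 0\<^sub>v n)"
    using blocks(1)
    unfolding append_cols_mult_vec[OF K1 z vX vU]
      append_cols_mult_vec[OF C1 append_cols_carrier[OF Bc z] xd uu] append_cols_mult_vec[OF Bc z ud]
      zero_mat_mult_vec[OF vU] zero_mat_mult_vec[OF ud(2)] .
  have b2: "kron_sum Psi (- Ac) *\<^sub>v ?vX + - kron (1\<^sub>m N) Bc *\<^sub>v ?vU
      = - kron sigma (1\<^sub>m n) *\<^sub>v x + (0\<^sub>v (N * n) + 0\<^sub>v (N * n))"
    using blocks(2)
    unfolding append_cols_mult_vec[OF K2 KB vX vU]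
      append_cols_mult_vec[OF KS append_cols_carrier[OF z z] xd uu] append_cols_mult_vec[OF z z ud]
      zero_mat_mult_vec[OF ud(1)] zero_mat_mult_vec[OF ud(2)] .
  have b3: "kron Phi (1\<^sub>m n) *\<^sub>v ?vX + 0\<^sub>v n = (Ad - b \<cdot>\<^sub>m 1\<^sub>m n) *\<^sub>v x + (Bd *\<^sub>v ?u + 0\<^sub>v n)"
    using blocks(3)
    unfolding append_cols_mult_vec[OF K3 z vX vU]
      append_cols_mult_vec[OF C3 append_cols_carrier[OF Bd z] xd uu] append_cols_mult_vec[OF Bd z ud]
      zero_mat_mult_vec[OF vU] zero_mat_mult_vec[OF ud(2)] .
  have sub: "((M - c \<cdot>\<^sub>m 1\<^sub>m n) *\<^sub>v x) $ k = (M *\<^sub>v x) $ k - c * x $ k"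
    if "M \<in> carrier_mat n n" for M c
  proof -
    have "(M - c \<cdot>\<^sub>m 1\<^sub>m n) *\<^sub>v x = M *\<^sub>v x - (c \<cdot>\<^sub>m 1\<^sub>m n) *\<^sub>v x"
      by (rule minus_mult_distrib_mat_vec[OF that _ xd]) simp
    also have "(c \<cdot>\<^sub>m 1\<^sub>m n) *\<^sub>v x = c \<cdot>\<^sub>v x"
      using xd by (auto intro!: eq_vecI)
    finally show ?thesis using k xd by (simp del: index_mult_mat_vec)
  qed
  have dims: "dim_vec (Bc *\<^sub>v ?u) = n" "dim_vec (Bd *\<^sub>v ?u) = n" using Bc Bd by auto
  show "poly (pderiv (\<phi> 0)) 0 * x $ k
      + (\<Sum>j<N. poly (pderiv (\<phi> (Suc j))) (qnode \<tau> N 0) * X $$ (k, j)) = (Ac *\<^sub>v x + Bc *\<^sub>v ?u) $ k"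
  proof -
    have "(kron psi (1\<^sub>m n) *\<^sub>v ?vX) $ k = (\<Sum>j<N. poly (pderiv (\<phi> (Suc j))) (qnode \<tau> N 0) * X $$ (k, j))"
      using kron_one_right_mult[OF psi X, of 0 k] k by (simp add: psi_def psi_mat_def \<phi>_def)
    then show ?thesis
      using arg_cong[OF b1, of "\<lambda>v. v $ k"] k dims sub[OF Ac, of a]
      by (simp add: a_def del: index_mult_mat_vec)
  qed
  show "poly (\<phi> 0) \<tau> * x $ k + (\<Sum>j<N. poly (\<phi> (Suc j)) \<tau> * X $$ (k, j))
      = (Ad *\<^sub>v x + Bd *\<^sub>v ?u) $ k"
  proof -
    have "(kron Phi (1\<^sub>m n) *\<^sub>v ?vX) $ k = (\<Sum>j<N. poly (\<phi> (Suc j)) \<tau> * X $$ (k, j))"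
      using kron_one_right_mult[OF Phi X, of 0 k] k by (simp add: Phi_def Phi_mat_def \<phi>_def)
    then show ?thesis
      using arg_cong[OF b3, of "\<lambda>v. v $ k"] k dims sub[OF Ad, of b]
      by (simp add: b_def del: index_mult_mat_vec)
  qed
  show "poly (pderiv (\<phi> 0)) (qnode \<tau> N (Suc r)) * x $ k
      + (\<Sum>j<N. poly (pderiv (\<phi> (Suc j))) (qnode \<tau> N (Suc r)) * X $$ (k, j))
      = (\<Sum>c<n. Ac $$ (k, c) * X $$ (c, r)) + (\<Sum>c<m. Bc $$ (k, c) * U $$ (c, r))"
    if r: "r < N" for r
  proof -
    note rk = block_index_less[OF r k]
    have k1: "kron Psi (1\<^sub>m n) \<in> carrier_mat (N * n) (N * n)" by (rule kron_carrier[OF Psi one_carrier_mat])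
    have k2: "kron (1\<^sub>m N) (- Ac) \<in> carrier_mat (N * n) (N * n)" by (rule kron_carrier[OF one_carrier_mat mAc])
    have dPsi: "dim_row Psi = N" "dim_row (- Ac) = n" using Psi Ac by auto
    have "kron_sum Psi (- Ac) *\<^sub>v ?vX = kron Psi (1\<^sub>m n) *\<^sub>v ?vX + kron (1\<^sub>m N) (- Ac) *\<^sub>v ?vX"
      unfolding kron_sum_def dPsi by (rule add_mult_distrib_mat_vec[OF k1 k2 vX])
    \<comment> \<open>After the transposition the row index selects the node and the column index
      the basis polynomial.\<close>
    moreover have "(kron Psi (1\<^sub>m n) *\<^sub>v ?vX) $ (r * n + k)
        = (\<Sum>j<N. poly (pderiv (\<phi> (Suc j))) (qnode \<tau> N (Suc r)) * X $$ (k, j))"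
      using kron_one_right_mult[OF Psi X r k] r
      by (simp add: Psi_def Psi_mat_def psi_mat_def \<phi>_def)
    moreover have "(kron (1\<^sub>m N) (- Ac) *\<^sub>v ?vX) $ (r * n + k) = - (\<Sum>c<n. Ac $$ (k, c) * X $$ (c, r))"
      using kron_one_left_mult[OF mAc X r k] Ac k by (simp add: sum_negf)
    moreover have "(- kron (1\<^sub>m N) Bc *\<^sub>v ?vU) $ (r * n + k) = - (\<Sum>c<m. Bc $$ (k, c) * U $$ (c, r))"
      using kron_one_left_mult[OF Bc U r k] kB vU rk by (simp del: index_mult_mat_vec)
    moreover have "(- kron sigma (1\<^sub>m n) *\<^sub>v x) $ (r * n + k) = - (poly (pderiv (\<phi> 0)) (qnode \<tau> N (Suc r)) * x $ k)"
      using kron_one_right_mult_vec[OF sigma xd r k] ks xd rk r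
      by (simp add: sigma_def sigma_mat_def \<phi>_def del: index_mult_mat_vec)
    moreover have "dim_vec (kron (1\<^sub>m N) (- Ac) *\<^sub>v ?vX) = N * n" "dim_vec (- kron (1\<^sub>m N) Bc *\<^sub>v ?vU) = N * n"
      using k2 KB by auto
    ultimately show ?thesis
      using arg_cong[OF b2, of "\<lambda>v. v $ (r * n + k)"] rk
      by (simp del: index_mult_mat_vec dim_mult_mat_vec)
  qed
qed

section \<open>The weighted norm\<close>

lemma diag_block_mat_scaled_ones:
  "diag_block_mat (map (\<lambda>j. w j \<cdot>\<^sub>m 1\<^sub>m n) js)
    = Matrix.mat (length js * n) (length js * n)
        (\<lambda>(i, j). if i = j then (w (js ! (i div n)) :: real) else 0)"
proof (induction js)
  case (Cons a js)
  show ?case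
    unfolding list.map(2) diag_block_mat.simps Let_def Cons.IH
  proof (rule eq_matI, goal_cases)
    case (1 i j)
    \<comment> \<open>An index within bounds excludes \<open>n = 0\<close>; then skipping the first
      block lowers \<open>i div n\<close> by exactly one.\<close>
    then have "0 < n" by (cases n) auto
    with 1 show ?case by (auto simp: le_div_geq)
  qed auto
qed (auto intro!: eq_matI)

text \<open>The quadratic form of \<open>G^T W G\<close> at \<open>v\<close> is that of
  \<open>W\<close> at \<open>G v\<close>, whose block \<open>r\<close> combines column
  \<open>r\<close> of \<open>X\<close> and of \<open>U\<close>. By the collocation equations this
  block is the derivative at node \<open>r + 1\<close>, so the squared norm is, up to a constant
  factor, the quadrature sum over the nodes other than 0.\<close>

lemma wnorm_Delta_mat:
  assumes Ac: "Ac \<in> carrier_mat n n" and Bc: "Bc \<in> carrier_mat n m"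
    and X: "X \<in> carrier_mat n N" and U: "U \<in> carrier_mat m N"
  shows "wnorm (Delta_mat \<tau> N Ac Bc) (vec_of_cols X @\<^sub>v vec_of_cols U)
    = sqrt (\<Sum>r<N. (\<tau> - qnode \<tau> N (Suc r)) / (poly (shifted_legendre \<tau> N) (qnode \<tau> N (Suc r)))\<^sup>2
        * (\<Sum>k<n. ((\<Sum>c<n. Ac $$ (k, c) * X $$ (c, r)) + (\<Sum>c<m. Bc $$ (k, c) * U $$ (c, r)))\<^sup>2))"
proof -
  define G where "G = kron (1\<^sub>m N) Ac @\<^sub>c kron (1\<^sub>m N) Bc"
  define W where "W = W_mat \<tau> N n"
  define v where "v = vec_of_cols X @\<^sub>v vec_of_cols U"
  define w where "w r = (\<tau> - qnode \<tau> N (Suc r)) / (poly (shifted_legendre \<tau> N) (qnode \<tau> N (Suc r)))\<^sup>2" for r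
  have kA: "kron (1\<^sub>m N) Ac \<in> carrier_mat (N * n) (N * n)" by (rule kron_carrier[OF one_carrier_mat Ac])
  have kB: "kron (1\<^sub>m N) Bc \<in> carrier_mat (N * n) (N * m)" by (rule kron_carrier[OF one_carrier_mat Bc])
  have vX: "vec_of_cols X \<in> carrier_vec (N * n)" and vU: "vec_of_cols U \<in> carrier_vec (N * m)"
    using X U by auto
  have G: "G \<in> carrier_mat (N * n) (N * n + N * m)"
    unfolding G_def by (rule append_cols_carrier[OF kA kB])
  have v: "v \<in> carrier_vec (N * n + N * m)" unfolding v_def using vX vU by simp
  \<comment> \<open>Position \<open>r\<close> of \<open>[1..<N + 1]\<close> holds
    \<open>r + 1\<close>, whence \<open>Suc r\<close> in \<open>w\<close>.\<close>
  have W_eq: "W = Matrix.mat (N * n) (N * n) (\<lambda>(i, j). if i = j then w (i div n) else 0)"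
    unfolding W_def W_mat_def diag_block_mat_scaled_ones
    by (rule eq_matI) (auto simp: w_def less_mult_imp_div_less nth_upt simp del: upt_Suc)
  then have W: "W \<in> carrier_mat (N * n) (N * n)" by simp
  define g where "g = G *\<^sub>v v"
  have g: "g \<in> carrier_vec (N * n)" unfolding g_def using G v by simp
  have g_index: "g $ (r * n + k)
      = (\<Sum>c<n. Ac $$ (k, c) * X $$ (c, r)) + (\<Sum>c<m. Bc $$ (k, c) * U $$ (c, r))"
    if "r < N" "k < n" for r k
    unfolding g_def G_def v_def append_cols_mult_vec[OF kA kB vX vU]
    using kron_one_left_mult[OF Ac X that] kron_one_left_mult[OF Bc U that] kB
      block_index_less[OF that] by (simp del: index_mult_mat_vec)
  have Wg: "(W *\<^sub>v g) $ i = w (i div n) * g $ i" if "i < N * n" for i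
  proof -
    have "(W *\<^sub>v g) $ i = (\<Sum>j<N * n. if j = i then w (i div n) * g $ i else 0)"
      unfolding mult_mat_vec_sum[OF W g that]
      by (rule sum.cong[OF refl]) (use that in \<open>auto simp: W_eq\<close>)
    then show ?thesis using that by simp
  qed
  have "v \<bullet> (Delta_mat \<tau> N Ac Bc *\<^sub>v v) = v \<bullet> (G\<^sup>T *\<^sub>v (W *\<^sub>v g))"
  proof -
    have "dim_row Ac = n" using Ac by simp
    then have "Delta_mat \<tau> N Ac Bc *\<^sub>v v = (G\<^sup>T * W * G) *\<^sub>v v"
      by (simp only: Delta_mat_def Let_def G_def W_def)
    also have "\<dots> = (G\<^sup>T * W) *\<^sub>v g"
      unfolding g_def using G W v by (intro assoc_mult_mat_vec) auto
    also have "\<dots> = G\<^sup>T *\<^sub>v (W *\<^sub>v g)"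
      using G W g by (intro assoc_mult_mat_vec) auto
    finally show ?thesis by simp
  qed
  also have "\<dots> = (G\<^sup>T *\<^sub>v (W *\<^sub>v g)) \<bullet> v"
    using v G W g
    by (intro comm_scalar_prod[where n = "N * n + N * m"] mult_mat_vec_carrier[where n = "N * n"]) auto
  also have "\<dots> = (W *\<^sub>v g) \<bullet> g"
    unfolding g_def using G W v by (intro transpose_vec_mult_scalar) auto
  also have "\<dots> = (\<Sum>i<N * n. w (i div n) * (g $ i)\<^sup>2)"
    unfolding scalar_prod_def
    using g Wg by (auto simp: atLeast0LessThan power2_eq_square mult.assoc intro!: sum.cong simp del: index_mult_mat_vec)
  also have "\<dots> = (\<Sum>r<N. \<Sum>i\<in>{r * n..<r * n + n}. w (i div n) * (g $ i)\<^sup>2)"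
    by (rule sum.nat_group[symmetric])
  also have "\<dots> = (\<Sum>r<N. w r
      * (\<Sum>k<n. ((\<Sum>c<n. Ac $$ (k, c) * X $$ (c, r)) + (\<Sum>c<m. Bc $$ (k, c) * U $$ (c, r)))\<^sup>2))"
  proof (rule sum.cong[OF refl])
    fix r assume "r \<in> {..<N}"
    then have r: "r < N" by simp
    have "(\<Sum>i\<in>{r * n..<r * n + n}. w (i div n) * (g $ i)\<^sup>2)
        = (\<Sum>k<n. w ((r * n + k) div n) * (g $ (r * n + k))\<^sup>2)"
      using sum.shift_bounds_nat_ivl[of "\<lambda>i. w (i div n) * (g $ i)\<^sup>2" 0 "r * n" n]
      by (simp add: add.commute atLeast0LessThan)
    also have "\<dots> = (\<Sum>k<n. w r
        * ((\<Sum>c<n. Ac $$ (k, c) * X $$ (c, r)) + (\<Sum>c<m. Bc $$ (k, c) * U $$ (c, r)))\<^sup>2)"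
      by (rule sum.cong[OF refl]) (simp add: g_index[OF r])
    finally show "(\<Sum>i\<in>{r * n..<r * n + n}. w (i div n) * (g $ i)\<^sup>2) = w r
        * (\<Sum>k<n. ((\<Sum>c<n. Ac $$ (k, c) * X $$ (c, r)) + (\<Sum>c<m. Bc $$ (k, c) * U $$ (c, r)))\<^sup>2)"
      by (simp add: sum_distrib_left)
  qed
  finally show ?thesis unfolding wnorm_def v_def w_def by simp
qed

section \<open>Euclidean norm and distance between regions\<close>

lemma vnorm_eq: "v \<in> carrier_vec n \<Longrightarrow> vnorm v = sqrt (\<Sum>k<n. (v $ k)\<^sup>2)"
  by (simp add: vnorm_def scalar_prod_def atLeast0LessThan power2_eq_square)

lemma vnorm_triangle:
  assumes "x \<in> carrier_vec n" "y \<in> carrier_vec n" "z \<in> carrier_vec n"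
  shows "vnorm (x - z) \<le> vnorm (x - y) + vnorm (y - z)"
proof -
  have "vnorm (x - z) = L2_set (\<lambda>k. (x $ k - y $ k) + (y $ k - z $ k)) {..<n}"
    using assms by (simp add: vnorm_eq[where n = n] L2_set_def)
  also have "\<dots> \<le> L2_set (\<lambda>k. x $ k - y $ k) {..<n} + L2_set (\<lambda>k. y $ k - z $ k) {..<n}"
    by (rule L2_set_triangle_ineq)
  also have "\<dots> = vnorm (x - y) + vnorm (y - z)"
    using assms by (simp add: vnorm_eq[where n = n] L2_set_def)
  finally show ?thesis .
qed

lemma vnorm_nonneg: "0 \<le> vnorm v"
  by (simp add: vnorm_def scalar_prod_def sum_nonneg)

text \<open>Triangle inequality through \<open>y\<close>, whose distance to \<open>Q\<close> is one
  of the values in the supremum defining the Hausdorff distance.\<close>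

lemma pt_dist_le_hausdorff:
  assumes "x \<in> carrier_vec n" "y \<in> P" "P \<subseteq> carrier_vec n" "Q \<subseteq> carrier_vec n" "vnorm (x - y) \<le> c"
  shows "pt_dist x Q \<le> ennreal c + hausdorff_dist P Q"
proof -
  have c: "0 \<le> c" using assms(5) vnorm_nonneg[of "x - y"] by linarith
  have "pt_dist x Q \<le> ennreal c + pt_dist y Q"
  \<comment> \<open>For empty \<open>Q\<close> the right-hand side is infinite.\<close>
  proof (cases "Q = {}")
    case False
    \<comment> \<open>Subtracting the finite \<open>c\<close> first leaves only the infimum over
      \<open>Q\<close> on the right, which can then be bounded pointwise.\<close>
    have "pt_dist x Q - ennreal c \<le> pt_dist y Q"
      unfolding pt_dist_def[of y]
    proof (rule INF_greatest)
      fix z assume z: "z \<in> Q"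
      have "pt_dist x Q \<le> ennreal (vnorm (x - z))"
        unfolding pt_dist_def using z by (rule INF_lower)
      also have "\<dots> \<le> ennreal (c + vnorm (y - z))"
      proof (rule ennreal_leI)
        have "vnorm (x - z) \<le> vnorm (x - y) + vnorm (y - z)"
          by (rule vnorm_triangle) (use assms z in auto)
        then show "vnorm (x - z) \<le> c + vnorm (y - z)" using assms(5) by simp
      qed
      also have "\<dots> = ennreal c + ennreal (vnorm (y - z))"
        using c vnorm_nonneg by (rule ennreal_plus)
      finally show "pt_dist x Q - ennreal c \<le> ennreal (vnorm (y - z))"
        by (simp add: ennreal_minus_le_iff)
    qed
    then show ?thesis by (simp add: ennreal_minus_le_iff)
  qed (simp add: pt_dist_def)
  also have "pt_dist y Q \<le> hausdorff_dist P Q"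
    unfolding hausdorff_dist_def using SUP_upper[OF assms(2), of "\<lambda>z. pt_dist z Q"]
    by (rule max.coboundedI1)
  then have "ennreal c + pt_dist y Q \<le> ennreal c + hausdorff_dist P Q"
    by (rule add_left_mono)
  finally show ?thesis .
qed

section \<open>Distance to a region\<close>

text \<open>\<open>a\<close> is the value at node 0 and \<open>b j\<close> the value at node
  \<open>j + 1\<close>, matching columns counted from 0.\<close>

definition lagrange_interpolant :: "real \<Rightarrow> nat \<Rightarrow> real \<Rightarrow> (nat \<Rightarrow> real) \<Rightarrow> real poly" where
  "lagrange_interpolant \<tau> N a b = Polynomial.smult a (lagrange \<tau> N 0)
     + (\<Sum>j<N. Polynomial.smult (b j) (lagrange \<tau> N (Suc j)))"

lemma poly_lagrange_interpolant:
  "poly (lagrange_interpolant \<tau> N a b) t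
    = poly (lagrange \<tau> N 0) t * a + (\<Sum>j<N. poly (lagrange \<tau> N (Suc j)) t * b j)"
  by (simp add: lagrange_interpolant_def poly_sum mult.commute)

lemma poly_pderiv_lagrange_interpolant:
  "poly (pderiv (lagrange_interpolant \<tau> N a b)) t
    = poly (pderiv (lagrange \<tau> N 0)) t * a + (\<Sum>j<N. poly (pderiv (lagrange \<tau> N (Suc j))) t * b j)"
  using higher_pderiv_sum[of 1 "\<lambda>j. Polynomial.smult (b j) (lagrange \<tau> N (Suc j))" "{..<N}"]
  by (simp add: lagrange_interpolant_def pderiv_add pderiv_smult poly_sum mult.commute)

lemma poly_lagrange_interpolant_qnode:
  assumes "0 < \<tau>" "j \<le> N"
  shows "poly (lagrange_interpolant \<tau> N a b) (qnode \<tau> N j) = (case j of 0 \<Rightarrow> a | Suc r \<Rightarrow> b r)"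
proof -
  have "poly (lagrange_interpolant \<tau> N a b) (qnode \<tau> N j)
      = (if 0 = j then a else 0) + (\<Sum>i<N. if Suc i = j then b i else 0)"
    unfolding poly_lagrange_interpolant
    using assms by (auto simp: poly_lagrange_qnode intro!: sum.cong)
  also have "\<dots> = (case j of 0 \<Rightarrow> a | Suc r \<Rightarrow> b r)"
    using assms(2) by (cases j) auto
  finally show ?thesis .
qed

lemma degree_lagrange_interpolant: "Polynomial.degree (lagrange_interpolant \<tau> N a b) \<le> N"
  unfolding lagrange_interpolant_def
  by (intro degree_add_le degree_sum_le order.trans[OF degree_smult_le] degree_lagrange) auto

definition step_traj ::
  "real \<Rightarrow> nat \<Rightarrow> nat \<Rightarrow> real Matrix.vec \<Rightarrow> real Matrix.mat \<Rightarrow> real \<Rightarrow> real Matrix.vec" where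
  "step_traj \<tau> N n x X t
    = Matrix.vec n (\<lambda>k. poly (lagrange_interpolant \<tau> N (x $ k) (\<lambda>j. X $$ (k, j))) t)"

text \<open>Both sides of the differential equation are polynomials of degree at most \<open>N\<close> that agree
  at the \<open>N + 1\<close> nodes; hence the interpolant of the columns of \<open>X\<close> is the exact solution.\<close>

lemma step_traj:
  fixes \<tau> :: real and N n m :: nat and ud :: "nat \<Rightarrow> real Matrix.vec"
  assumes Ac: "Ac \<in> carrier_mat n n" and Bc: "Bc \<in> carrier_mat n m"
    and Ad: "Ad \<in> carrier_mat n n" and Bd: "Bd \<in> carrier_mat n m"
    and X: "X \<in> carrier_mat n N" and U: "U \<in> carrier_mat m N"
    and xd: "dt_traj Ad Bd x0 ud i \<in> carrier_vec n"
    and ud: "ud i \<in> carrier_vec m" "ud (i + 1) \<in> carrier_vec m"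
    and eq: "step_equation \<tau> N Ac Bc Ad Bd x0 ud i X U"
    and inp: "step_input \<tau> N ud i U uci"
    and \<tau>: "0 < \<tau>"
  defines "y \<equiv> step_traj \<tau> N n (dt_traj Ad Bd x0 ud i) X"
  shows "y 0 = dt_traj Ad Bd x0 ud i"
    and "y \<tau> = dt_traj Ad Bd x0 ud (Suc i)"
    and "0 \<le> T \<Longrightarrow> T \<le> \<tau> \<Longrightarrow> ct_solution Ac Bc (dt_traj Ad Bd x0 ud i) uci T y"
    and "s \<in> {0..\<tau>} \<Longrightarrow> t \<in> {0..\<tau>} \<Longrightarrow> vnorm (y s - y t) \<le>
      \<tau> / (real N + 1) * vnorm (Ac *\<^sub>v dt_traj Ad Bd x0 ud i + Bc *\<^sub>v ud i)
      + sqrt \<tau> / (real N + 1) * wnorm (Delta_mat \<tau> N Ac Bc) (vec_of_cols X @\<^sub>v vec_of_cols U)"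
proof -
  define x where "x = dt_traj Ad Bd x0 ud i"
  define v0 where "v0 = Ac *\<^sub>v x + Bc *\<^sub>v ud i"
  define V where "V r k = (\<Sum>c<n. Ac $$ (k, c) * X $$ (c, r)) + (\<Sum>c<m. Bc $$ (k, c) * U $$ (c, r))" for r k
  define p where "p k = lagrange_interpolant \<tau> N (x $ k) (\<lambda>j. X $$ (k, j))" for k
  define q where "q c = lagrange_interpolant \<tau> N (ud i $ c) (\<lambda>j. U $$ (c, j))" for c
  have y_def: "y t = Matrix.vec n (\<lambda>k. poly (p k) t)" for t
    by (simp add: y_def step_traj_def p_def x_def)
  have x: "x \<in> carrier_vec n" using xd by (simp add: x_def)
  note eqs = step_equationD[OF Ac Bc Ad Bd X U xd ud eq, folded x_def]
  have deg_p: "Polynomial.degree (p k) \<le> N" for k unfolding p_def by (rule degree_lagrange_interpolant)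
  have deg_q: "Polynomial.degree (q k) \<le> N" for k unfolding q_def by (rule degree_lagrange_interpolant)
  note node = poly_lagrange_interpolant_qnode[OF \<tau>, where N = N]
  have p_0: "poly (p k) 0 = x $ k" for k
    using node[of 0] by (simp add: p_def qnode_0[OF \<tau>])
  have q_0: "poly (q k) 0 = ud i $ k" for k
    using node[of 0] by (simp add: q_def qnode_0[OF \<tau>])
  have p_node: "poly (p k) (qnode \<tau> N (Suc r)) = X $$ (k, r)" if "r < N" for k r
    using node[of "Suc r"] that by (simp add: p_def)
  have q_node: "poly (q k) (qnode \<tau> N (Suc r)) = U $$ (k, r)" if "r < N" for k r
    using node[of "Suc r"] that by (simp add: q_def)
  have pd: "poly (pderiv (p k)) t = poly (pderiv (lagrange \<tau> N 0)) t * x $ k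
      + (\<Sum>j<N. poly (pderiv (lagrange \<tau> N (Suc j))) t * X $$ (k, j))" for k t
    by (simp add: p_def poly_pderiv_lagrange_interpolant)
  have d_0: "poly (pderiv (p k)) 0 = v0 $ k" if "k < n" for k
    using eqs(1)[OF that] unfolding pd v0_def qnode_0[OF \<tau>] .
  have d_node: "poly (pderiv (p k)) (qnode \<tau> N (Suc r)) = V r k" if "k < n" "r < N" for k r
    using eqs(2)[OF that] unfolding pd V_def .
  have ode: "pderiv (p k) = (\<Sum>c<n. Polynomial.smult (Ac $$ (k, c)) (p c))
      + (\<Sum>c<m. Polynomial.smult (Bc $$ (k, c)) (q c))" (is "_ = ?r") if k: "k < n" for k
  proof (rule poly_eqI_degree)
    have card: "card (qnode \<tau> N ` {..N}) = Suc N"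
      using inj_on_qnode[OF \<tau>] by (simp add: card_image)
    show "Polynomial.degree (pderiv (p k)) < card (qnode \<tau> N ` {..N})"
      using deg_p[of k] card by (simp add: degree_pderiv)
    have "Polynomial.degree ?r \<le> N"
      by (intro degree_add_le degree_sum_le order.trans[OF degree_smult_le] deg_p deg_q) auto
    then show "Polynomial.degree ?r < card (qnode \<tau> N ` {..N})"
      using card by simp
    fix t assume "t \<in> qnode \<tau> N ` {..N}"
    then obtain j where j: "j \<le> N" "t = qnode \<tau> N j" by auto
    show "poly (pderiv (p k)) t = poly ?r t"
    proof (cases j)
      case 0
      then have t: "t = 0" using j qnode_0[OF \<tau>] by simp
      have "v0 $ k = (Ac *\<^sub>v x) $ k + (Bc *\<^sub>v ud i) $ k"
        using k Bc by (simp add: v0_def del: index_mult_mat_vec)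
      then show ?thesis
        using mult_mat_vec_sum[OF Ac x k] mult_mat_vec_sum[OF Bc ud(1) k]
        by (simp add: t d_0[OF k] poly_sum p_0 q_0 del: index_mult_mat_vec)
    next
      case (Suc r)
      then show ?thesis
        using j d_node[OF k, of r] by (simp add: poly_sum p_node q_node V_def)
    qed
  qed
  show y0: "y 0 = dt_traj Ad Bd x0 ud i"
    using x by (auto simp: y_def p_0 x_def intro!: eq_vecI)
  show "y \<tau> = dt_traj Ad Bd x0 ud (Suc i)"
  proof (rule eq_vecI)
    show "dim_vec (y \<tau>) = dim_vec (dt_traj Ad Bd x0 ud (Suc i))"
      using Bd by (simp add: y_def)
    fix k assume "k < dim_vec (dt_traj Ad Bd x0 ud (Suc i))"
    then have k: "k < n" using Bd by simp
    have "poly (p k) \<tau> = poly (lagrange \<tau> N 0) \<tau> * x $ k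
        + (\<Sum>j<N. poly (lagrange \<tau> N (Suc j)) \<tau> * X $$ (k, j))"
      by (simp add: p_def poly_lagrange_interpolant)
    also have "\<dots> = (Ad *\<^sub>v x + Bd *\<^sub>v ud i) $ k" by (rule eqs(3)[OF k])
    finally show "y \<tau> $ k = dt_traj Ad Bd x0 ud (Suc i) $ k"
      using k by (simp add: y_def x_def del: index_add_vec)
  qed
  have y: "y t \<in> carrier_vec n" for t by (simp add: y_def)
  show "ct_solution Ac Bc (dt_traj Ad Bd x0 ud i) uci T y" if T: "0 \<le> T" "T \<le> \<tau>"
  proof -
    have "((\<lambda>r. y r $ k) has_real_derivative (Ac *\<^sub>v y s + Bc *\<^sub>v uci s) $ k) (at s within {0..T})"
      if s: "s \<in> {0..T}" and k: "k < n" for s k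
    proof -
      \<comment> \<open>On \<open>[0, \<tau>]\<close> the input is the interpolant \<open>q\<close>;
        the sum of \<open>step_input\<close> pairs node \<open>j\<close> with column
        \<open>j - 1\<close>, so its index is shifted.\<close>
      have "uci s = Matrix.vec m (\<lambda>c. poly (q c) s)"
      proof -
        have "poly (q c) s = poly (lagrange \<tau> N 0) s * ud i $ c
            + (\<Sum>j=1..N. poly (lagrange \<tau> N j) s * Matrix.col U (j - 1) $ c)" if "c < m" for c
          using that U by (simp add: q_def poly_lagrange_interpolant sum.atLeast1_atMost_eq)
        then show ?thesis
          using inp s T U by (auto simp: step_input_def intro!: eq_vecI)
      qed
      then have u: "uci s \<in> carrier_vec m" "\<And>c. c < m \<Longrightarrow> uci s $ c = poly (q c) s"
        by simp_all
      have "(Ac *\<^sub>v y s + Bc *\<^sub>v uci s) $ k = (Ac *\<^sub>v y s) $ k + (Bc *\<^sub>v uci s) $ k"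
        using k Bc by (simp del: index_mult_mat_vec)
      also have "\<dots> = poly (pderiv (p k)) s"
        unfolding mult_mat_vec_sum[OF Ac y k] mult_mat_vec_sum[OF Bc u(1) k] ode[OF k]
        by (simp add: poly_sum y_def u(2))
      finally show ?thesis
        using k by (auto simp: y_def intro!: has_field_derivative_at_within poly_DERIV)
    qed
    then show ?thesis using Ac y y0 unfolding ct_solution_def by auto
  qed
  show "vnorm (y s - y t) \<le>
      \<tau> / (real N + 1) * vnorm (Ac *\<^sub>v dt_traj Ad Bd x0 ud i + Bc *\<^sub>v ud i)
      + sqrt \<tau> / (real N + 1) * wnorm (Delta_mat \<tau> N Ac Bc) (vec_of_cols X @\<^sub>v vec_of_cols U)"
    if "s \<in> {0..\<tau>}" "t \<in> {0..\<tau>}"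
  proof -
    define w where "w r = (\<tau> - qnode \<tau> N (Suc r)) / (poly (shifted_legendre \<tau> N) (qnode \<tau> N (Suc r)))\<^sup>2" for r
    define S where "S = (\<Sum>r<N. w r * (\<Sum>k<n. (V r k)\<^sup>2))"
    have "0 \<le> w r" if "r < N" for r
      using qnode_less[OF \<tau>, of "Suc r" N] that by (simp add: w_def)
    then have "0 \<le> S" unfolding S_def by (intro sum_nonneg mult_nonneg_nonneg) auto
    have v0: "v0 \<in> carrier_vec n"
      unfolding v0_def using Ac Bc x ud(1) by (intro add_carrier_vec mult_mat_vec_carrier)
    have "(vnorm (y s - y t))\<^sup>2 = (\<Sum>k<n. (poly (p k) s - poly (p k) t)\<^sup>2)"
      by (subst vnorm_eq[where n = n]) (auto simp: y_def intro!: sum_nonneg)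
    also have "\<dots> \<le> (\<Sum>k<n. \<tau> / (real (Suc N))\<^sup>2 * (\<tau> * (v0 $ k)\<^sup>2 + (\<Sum>r<N. w r * (V r k)\<^sup>2)))"
    proof (rule sum_mono)
      fix k assume "k \<in> {..<n}"
      then have k: "k < n" by simp
      have "(\<Sum>j=1..N. (\<tau> - qnode \<tau> N j) / (poly (shifted_legendre \<tau> N) (qnode \<tau> N j))\<^sup>2
          * (poly (pderiv (p k)) (qnode \<tau> N j))\<^sup>2) = (\<Sum>r<N. w r * (V r k)\<^sup>2)"
        using d_node[OF k] by (simp add: sum.atLeast1_atMost_eq w_def)
      then show "(poly (p k) s - poly (p k) t)\<^sup>2
          \<le> \<tau> / (real (Suc N))\<^sup>2 * (\<tau> * (v0 $ k)\<^sup>2 + (\<Sum>r<N. w r * (V r k)\<^sup>2))"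
        using poly_increment_le_qnodes[OF \<tau> deg_p[of k] that] unfolding d_0[OF k] by (simp only:)
    qed
    also have "\<dots> = \<tau> / (real (Suc N))\<^sup>2 * (\<tau> * (\<Sum>k<n. (v0 $ k)\<^sup>2) + (\<Sum>k<n. \<Sum>r<N. w r * (V r k)\<^sup>2))"
      by (simp only: sum_distrib_left[symmetric] sum.distrib)
    \<comment> \<open>Exchanging components and nodes turns the node terms into the square of the
      \<open>Delta_mat\<close> norm.\<close>
    also have "(\<Sum>k<n. \<Sum>r<N. w r * (V r k)\<^sup>2) = S"
      unfolding S_def sum_distrib_left by (rule sum.swap)
    also have "(\<Sum>k<n. (v0 $ k)\<^sup>2) = (vnorm v0)\<^sup>2"
      by (simp add: vnorm_eq[OF v0] sum_nonneg)
    also have "\<tau> / (real (Suc N))\<^sup>2 * (\<tau> * (vnorm v0)\<^sup>2 + S)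
        = (\<tau> / real (Suc N) * vnorm v0)\<^sup>2 + (sqrt \<tau> / real (Suc N) * sqrt S)\<^sup>2"
      using \<tau> \<open>0 \<le> S\<close> by (simp add: power_mult_distrib power_divide power2_eq_square[of \<tau>] distrib_left)
    \<comment> \<open>\<open>a^2 + b^2 \<le> (a + b)^2\<close> for nonnegative \<open>a\<close> and
      \<open>b\<close> separates the two norms.\<close>
    also have "\<dots> \<le> (\<tau> / real (Suc N) * vnorm v0 + sqrt \<tau> / real (Suc N) * sqrt S)\<^sup>2"
      using \<tau> \<open>0 \<le> S\<close> vnorm_nonneg[of v0] by (simp add: power2_sum)
    finally have "vnorm (y s - y t) \<le> \<tau> / real (Suc N) * vnorm v0 + sqrt \<tau> / real (Suc N) * sqrt S"
      by (rule power2_le_imp_le) (use \<tau> \<open>0 \<le> S\<close> vnorm_nonneg[of v0] in simp)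
    then show ?thesis
      unfolding wnorm_Delta_mat[OF Ac Bc X U] S_def w_def V_def v0_def x_def
      by (simp add: add.commute)
  qed
qed

section \<open>The trajectory across the sampling intervals\<close>

lemma dt_traj_carrier:
  assumes "Bd \<in> carrier_mat n m" "x0 \<in> carrier_vec n"
  shows "dt_traj Ad Bd x0 ud k \<in> carrier_vec n"
  using assms by (cases k) (auto intro!: carrier_vecI)

lemma ct_solution_cong:
  assumes "ct_solution A B x0 u T x" "\<And>s. s \<in> {0..T} \<Longrightarrow> u s = u' s"
  shows "ct_solution A B x0 u' T x"
  using assms by (simp add: ct_solution_def)

text \<open>One-step trajectories are concatenated: each ends at the discrete state where the next
  begins.\<close>

lemma ct_solution_at_samples:
  assumes Ac: "Ac \<in> carrier_mat n n" and Bc: "Bc \<in> carrier_mat n m"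
    and Ad: "Ad \<in> carrier_mat n n" and Bd: "Bd \<in> carrier_mat n m"
    and "x0 \<in> carrier_vec n" and ud: "\<forall>k\<le>l. ud k \<in> carrier_vec m" and \<tau>: "0 < \<tau>"
    and uc: "uc \<in> input_set \<tau> N Ac Bc Ad Bd l x0 ud" and "k \<le> l"
  shows "\<exists>x. ct_solution Ac Bc x0 uc (real k * \<tau>) x \<and> x (real k * \<tau>) = dt_traj Ad Bd x0 ud k"
  using \<open>k \<le> l\<close>
proof (induction k)
  case 0
  \<comment> \<open>With horizon 0 the derivative is taken within a single point, where every value
    is a derivative.\<close>
  have "ct_solution Ac Bc x0 uc 0 (\<lambda>_. x0)"
    using Ac \<open>x0 \<in> carrier_vec n\<close>
    by (simp add: ct_solution_def has_field_derivative_def has_derivative_within_singleton_iff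
        bounded_linear_mult_right)
  then show ?case by auto
next
  case (Suc k)
  then obtain x where x: "ct_solution Ac Bc x0 uc (real k * \<tau>) x" "x (real k * \<tau>) = dt_traj Ad Bd x0 ud k"
    by auto
  have "k < l" using Suc.prems by simp
  with uc obtain uci where uci: "uci \<in> step_input_set \<tau> N Ac Bc Ad Bd x0 ud k"
    "\<forall>t\<in>{0..\<tau>}. uc (real k * \<tau> + t) = uci t"
    unfolding input_set_def by blast
  then obtain X U where X: "X \<in> carrier_mat n N" and U: "U \<in> carrier_mat m N"
    and eq: "step_equation \<tau> N Ac Bc Ad Bd x0 ud k X U" and inp: "step_input \<tau> N ud k U uci"
    unfolding step_input_set_def using Ac Bc by auto
  have u: "ud k \<in> carrier_vec m" "ud (k + 1) \<in> carrier_vec m" using ud \<open>k < l\<close> by auto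
  define y where "y = step_traj \<tau> N n (dt_traj Ad Bd x0 ud k) X"
  note step = step_traj[OF Ac Bc Ad Bd X U dt_traj_carrier[OF Bd assms(5)] u eq inp \<tau>, folded y_def]
  have "ct_solution Ac Bc (x (real k * \<tau>)) (\<lambda>s. uc (real k * \<tau> + s)) \<tau> y"
    unfolding x(2)
    by (rule ct_solution_cong[of _ _ _ uci]) (use step(3)[of \<tau>] \<tau> uci(2) in \<open>simp_all\<close>)
  from ct_solution_append[OF Ac x(1) this] \<tau>
  have "ct_solution Ac Bc x0 uc (real k * \<tau> + \<tau>)
      (\<lambda>s. if s \<in> {0..real k * \<tau>} then x s else y (s - real k * \<tau>))"
    by simp
  moreover have "y \<tau> = dt_traj Ad Bd x0 ud (Suc k)"
    by (rule step(2))
  moreover have "real (Suc k) * \<tau> = real k * \<tau> + \<tau>" by (simp add: algebra_simps)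
  ultimately show ?case
    using \<tau> by (intro exI[of _ "\<lambda>s. if s \<in> {0..real k * \<tau>} then x s else y (s - real k * \<tau>)"])
      (simp del: of_nat_Suc dt_traj.simps)
qed

theorem theorem4:
  fixes n m N l i :: nat and \<tau> :: real
    and Ac Bc Ad Bd X U :: "real Matrix.mat"
    and x0 :: "real Matrix.vec"
    and ud :: "nat \<Rightarrow> real Matrix.vec"
    and uc uci :: "real \<Rightarrow> real Matrix.vec"
    and R :: "nat \<Rightarrow> real Matrix.vec set"
    and R' :: "real Matrix.vec set"
  assumes "0 < n" and "0 < m"
    and "Ac \<in> carrier_mat n n" and "Bc \<in> carrier_mat n m"
    and "Ad \<in> carrier_mat n n" and "Bd \<in> carrier_mat n m"
    and "0 < \<tau>" and "1 \<le> N"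
    and "interpolator N \<tau> Ac Bc Ad Bd"
    and "0 < l"
    and "\<forall>k\<le>l. R k \<subseteq> carrier_vec n"
    and "x0 \<in> carrier_vec n"
    and "\<forall>k\<le>l. ud k \<in> carrier_vec m"
    and "\<forall>k\<le>l. dt_traj Ad Bd x0 ud k \<in> R k"
    and "uc \<in> input_set \<tau> N Ac Bc Ad Bd l x0 ud"
    and "i < l"
    and "uci \<in> step_input_set \<tau> N Ac Bc Ad Bd x0 ud i"
    and "X \<in> carrier_mat n N" and "U \<in> carrier_mat m N"
    and "\<forall>t\<in>{0..\<tau>}. uc (real i * \<tau> + t) = uci t"
    and "step_equation \<tau> N Ac Bc Ad Bd x0 ud i X U"
    and "step_input \<tau> N ud i U uci"
    and "R' \<subseteq> carrier_vec n"
  shows "\<forall>t\<in>{0..\<tau>}.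
    pt_dist (ct_traj Ac Bc x0 uc (real i * \<tau> + t)) R'
    \<le> ennreal (sqrt 6 * \<tau> * real N / (real N + 1)
          * vnorm (Ac *\<^sub>v dt_traj Ad Bd x0 ud i + Bc *\<^sub>v ud i)
        + sqrt (6 * \<tau>) * real N / (real N + 1)
          * wnorm (Delta_mat \<tau> N Ac Bc) (vec_of_cols X @\<^sub>v vec_of_cols U))
      + min (hausdorff_dist (R i) R') (hausdorff_dist (R (i + 1)) R')"
proof
  fix t assume t: "t \<in> {0..\<tau>}"
  note Ac = assms(3) and Bc = assms(4) and Ad = assms(5) and Bd = assms(6) and \<tau> = assms(7)
    and X = assms(18) and U = assms(19)
  have u: "ud i \<in> carrier_vec m" "ud (i + 1) \<in> carrier_vec m"
    using assms(13) \<open>i < l\<close> by auto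
  define y where "y = step_traj \<tau> N n (dt_traj Ad Bd x0 ud i) X"
  note xd = dt_traj_carrier[OF Bd assms(12)]
  note step = step_traj[OF Ac Bc Ad Bd X U xd u assms(21,22) \<tau>, folded y_def]
  obtain x where x: "ct_solution Ac Bc x0 uc (real i * \<tau>) x" "x (real i * \<tau>) = dt_traj Ad Bd x0 ud i"
    using ct_solution_at_samples[OF Ac Bc Ad Bd assms(12,13) \<tau> assms(15), of i] \<open>i < l\<close> by auto
  have "ct_solution Ac Bc (x (real i * \<tau>)) (\<lambda>s. uc (real i * \<tau> + s)) t y"
    unfolding x(2)
    by (rule ct_solution_cong[of _ _ _ uci]) (use step(3)[of t] t assms(20) in simp_all)
  from ct_traj_eq[OF Ac Bc ct_solution_append[OF Ac x(1) this]]
  have "ct_traj Ac Bc x0 uc (real i * \<tau> + t)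
      = (if real i * \<tau> + t \<in> {0..real i * \<tau>} then x (real i * \<tau> + t) else y t)"
    using t \<tau> by simp
  \<comment> \<open>The first branch applies only for \<open>t = 0\<close>, where
    \<open>x (i * \<tau>)\<close> and \<open>y 0\<close> coincide.\<close>
  also have "\<dots> = y t"
    using t x(2) step(1) by auto
  finally have traj: "ct_traj Ac Bc x0 uc (real i * \<tau> + t) = y t" .
  let ?v = "vnorm (Ac *\<^sub>v dt_traj Ad Bd x0 ud i + Bc *\<^sub>v ud i)"
  let ?w = "wnorm (Delta_mat \<tau> N Ac Bc) (vec_of_cols X @\<^sub>v vec_of_cols U)"
  let ?c = "sqrt 6 * \<tau> * real N / (real N + 1) * ?v + sqrt (6 * \<tau>) * real N / (real N + 1) * ?w"
  have w: "0 \<le> ?w"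
    unfolding wnorm_Delta_mat[OF Ac Bc X U]
    using qnode_less[OF \<tau>]
    by (intro real_sqrt_ge_zero sum_nonneg mult_nonneg_nonneg divide_nonneg_nonneg) (auto simp: less_imp_le)
  \<comment> \<open>With this factor at least 1, the sharper one-step bound implies the one with the
    stated constants.\<close>
  have "1 \<le> sqrt 6 * real N"
    using mult_mono[of 1 "sqrt 6" 1 "real N"] \<open>1 \<le> N\<close> by simp
  then have "\<tau> / (real N + 1) * ?v + sqrt \<tau> / (real N + 1) * ?w
      \<le> sqrt 6 * real N * (\<tau> / (real N + 1) * ?v + sqrt \<tau> / (real N + 1) * ?w)"
    using w \<tau> vnorm_nonneg mult_right_mono[of 1 "sqrt 6 * real N"] by fastforce
  also have "\<dots> = ?c"
    by (simp add: real_sqrt_mult algebra_simps)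
  finally have bound: "vnorm (y t - y s) \<le> ?c" if "s \<in> {0..\<tau>}" for s
    using step(4)[OF t that] by linarith
  \<comment> \<open>The reference times \<open>s = 0\<close> and \<open>s = \<tau>\<close>, with
    states in \<open>R i\<close> and \<open>R (i + 1)\<close>, give the two terms of the
    minimum.\<close>
  have near: "pt_dist (y t) R' \<le> ennreal ?c + hausdorff_dist (R k) R'"
    if "k \<le> l" "s \<in> {0..\<tau>}" "y s = dt_traj Ad Bd x0 ud k" for k s
  proof (rule pt_dist_le_hausdorff)
    show "y t \<in> carrier_vec n" by (simp add: y_def step_traj_def)
    show "dt_traj Ad Bd x0 ud k \<in> R k" "R k \<subseteq> carrier_vec n" "R' \<subseteq> carrier_vec n"
      using assms(11,14,23) that(1) by auto
    show "vnorm (y t - dt_traj Ad Bd x0 ud k) \<le> ?c"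
      using bound[OF that(2)] that(3) by simp
  qed
  have "pt_dist (y t) R' \<le> ennreal ?c + hausdorff_dist (R i) R'"
    using \<open>i < l\<close> \<tau> by (intro near[of i 0] step(1)) auto
  moreover have "pt_dist (y t) R' \<le> ennreal ?c + hausdorff_dist (R (i + 1)) R'"
    using \<open>i < l\<close> \<tau> step(2) by (intro near[of "i + 1" \<tau>]) auto
  ultimately show "pt_dist (ct_traj Ac Bc x0 uc (real i * \<tau> + t)) R'
      \<le> ennreal ?c + min (hausdorff_dist (R i) R') (hausdorff_dist (R (i + 1)) R')"
    unfolding traj by (simp add: min_def)
qed

end
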